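(* Let $Q$ be any prime power. The classical relative difference set $$\mathcal{E}=\{x\in\mathbb{F}_{Q^2}^\times: x+x^Q=1\}$$ for the group $\mathbb{F}_{Q^2}^\times$, relative to the subgroup $\mathbb{F}_Q^\times$, can be shifted (i.e. multiplied by some element of $\mathbb{F}_{Q^2}^\times$) to produce a simplicial $\mathrm{RDS}(Q+1,Q-1,Q,1)$. Moreover, for any integer $J\geq2$, the complement $$\{\overline{x}\in\mathbb{F}_{Q^{2J}}^\times/\mathbb{F}_Q^\times:\operatorname{tr}_{Q^{2J}/Q}(x)\neq0\}$$ of the Singer difference set in the cyclic group $\mathcal{G}=\mathbb{F}_{Q^{2J}}^\times/\mathbb{F}_Q^\times$ of order $\frac{Q^{2J}-1}{Q-1}$ can be shifted (i.e. multiplied by some element of $\mathcal{G}$) so as to produce a $Q^{2J-1}$-element composite difference set $\mathcal{D}$ for $\mathcal{G}$, and the resulting factors $\mathcal{A}$ and $\mathcal{B}$ (with $\chi_{\mathcal{D}}=\chi_{\mathcal{A}}*\chi_{\mathcal{B}}$) are, respectively, a simplicial $\mathrm{RDS}(Q^J+1,\frac{Q^J-1}{Q-1},Q^J,Q-1)$ for $\mathcal{G}$, relative to the $\frac{Q^J-1}{Q-1}$-element subgroup $\mathcal{H}=\mathbb{F}_{Q^J}^\times/\mathbb{F}_Q^\times$ of $\mathcal{G}$, and the complement $\{\overline{z}\in\mathbb{F}_{Q^J}^\times/\mathbb{F}_Q^\times:\operatorname{tr}_{Q^J/Q}(z)\neq0\}$ of the Singer difference set for $\mathcal{H}$.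
   Context: For a prime power $Q$, $\mathbb{F}_Q$ is the field of order $Q$ and $\mathbb{F}_Q^\times$ its multiplicative group. The field trace is $\operatorname{tr}_{Q^J/Q}:\mathbb{F}_{Q^J}\to\mathbb{F}_Q$, $\operatorname{tr}_{Q^J/Q}(x)=\sum_{j=0}^{J-1}x^{Q^j}$. The groups in the claim are written multiplicatively, $\overline{x}$ denotes the coset $x\mathbb{F}_Q^\times$, and the definitions below, phrased additively for a finite abelian group $\mathcal{G}$, are to be translated accordingly. The Singer difference set for $\mathbb{F}_{Q^J}^\times/\mathbb{F}_Q^\times$ is $\{\overline{x}:\operatorname{tr}_{Q^J/Q}(x)=0\}$. A subset $\mathcal{D}$ of a finite abelian group $\mathcal{G}$ is a difference set for $\mathcal{G}$ if every nonidentity element of $\mathcal{G}$ can be written as a difference of members of $\mathcal{D}$ in the same number of ways. For a subgroup $\mathcal{H}$ of order $H$ of $\mathcal{G}$ of order $G$, a subset $\mathcal{A}$ of $\mathcal{G}$ is an $\mathcal{H}$-relative difference set ($\mathcal{H}$-RDS) if no nonidentity member of $\mathcal{H}$ is a difference of two members of $\mathcal{A}$, while every $g\notin\mathcal{H}$ can be written as such a difference in the same number $\Lambda$ of ways; with $k=\#(\mathcal{A})$, it is denoted an $\mathrm{RDS}(\frac{G}{H},H,k,\Lambda)$. It is simplicial if moreover $\mathcal{A}$ is a set of representatives of the nonidentity cosets of $\mathcal{H}$. A nonempty $D$-element difference set $\mathcal{D}$ for $\mathcal{G}$ of order $G$ is $\mathcal{H}$-fine, for a subgroup $\mathcal{H}$,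 if $\mathcal{D}\cap\mathcal{H}=\emptyset$ and $\mathcal{H}$ has order $\frac{G}{S+1}$, where $S=\left[\frac{D(G-1)}{G-D}\right]^{1/2}$. It is composite if it is $\mathcal{H}$-fine for some subgroup $\mathcal{H}$ of $\mathcal{G}$ and moreover there exist an $S$-element subset $\mathcal{A}$ of $\mathcal{G}$ and a difference set $\mathcal{B}$ for $\mathcal{H}$ such that $\chi_{\mathcal{D}}=\chi_{\mathcal{A}}*\chi_{\mathcal{B}}$; these $\mathcal{A},\mathcal{B}$ are the factors of $\mathcal{D}$. Here $\chi_{\mathcal{X}}$ is the characteristic function of $\mathcal{X}\subseteq\mathcal{G}$ and $*$ is convolution over $\mathcal{G}$, $(\mathbf{x}_1*\mathbf{x}_2)(g)=\sum_{g'\in\mathcal{G}}\mathbf{x}_1(g')\mathbf{x}_2(g-g')$; so the last identity says that each element of $\mathcal{D}$ is uniquely the group product of a member of $\mathcal{A}$ and a member of $\mathcal{B}$, and all such products lie in $\mathcal{D}$. The assertion about the resulting factors means that there is such a factorization with $\mathcal{A}$ and $\mathcal{B}$ of the stated form. *)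

theory Defs
  imports
    Complex_Main
    "HOL-Library.Indicator_Function"
    "HOL-Algebra.Multiplicative_Group"
    "HOL-Algebra.Elementary_Groups"
    "HOL-Algebra.Subrings"
    "HOL-Number_Theory.Prime_Powers"
begin

section \<open>Difference sets and relative difference sets\<close>

text \<open>Groups are written multiplicatively, so a "difference" of $a$ and $b$ is $a b^{-1}$.\<close>

definition diff_count :: "('g, 'x) monoid_scheme \<Rightarrow> 'g set \<Rightarrow> 'g \<Rightarrow> nat" where
  "diff_count G D g = card {(a, b). a \<in> D \<and> b \<in> D \<and> a \<otimes>\<^bsub>G\<^esub> inv\<^bsub>G\<^esub> b = g}"

definition difference_set :: "('g, 'x) monoid_scheme \<Rightarrow> 'g set \<Rightarrow> bool" where
  "difference_set G D \<longleftrightarrow>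
     comm_group G \<and> finite (carrier G) \<and> D \<subseteq> carrier G \<and>
     (\<exists>\<Lambda>. \<forall>g \<in> carrier G - {\<one>\<^bsub>G\<^esub>}. diff_count G D g = \<Lambda>)"

text \<open>\<open>is_RDS G H A m n k \<Lambda>\<close>: the set \<open>A\<close> is an \<open>H\<close>-relative difference set for \<open>G\<close> of
  type $\mathrm{RDS}(m,n,k,\Lambda)$, where $m = |G|/|H|$, $n = |H|$ and $k = |A|$.\<close>

definition is_RDS ::
  "('g, 'x) monoid_scheme \<Rightarrow> 'g set \<Rightarrow> 'g set \<Rightarrow> nat \<Rightarrow> nat \<Rightarrow> nat \<Rightarrow> nat \<Rightarrow> bool" where
  "is_RDS G H A m n k \<Lambda> \<longleftrightarrow>
     comm_group G \<and> finite (carrier G) \<and> subgroup H G \<and> A \<subseteq> carrier G \<and>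
     order G = m * n \<and> card H = n \<and> card A = k \<and>
     (\<forall>h \<in> H - {\<one>\<^bsub>G\<^esub>}. diff_count G A h = 0) \<and>
     (\<forall>g \<in> carrier G - H. diff_count G A g = \<Lambda>)"

text \<open>The bijection says that \<open>A\<close> contains exactly one element of each coset of \<open>H\<close> other than
  \<open>H\<close> itself, and no element of \<open>H\<close>.\<close>

definition simplicial_RDS ::
  "('g, 'x) monoid_scheme \<Rightarrow> 'g set \<Rightarrow> 'g set \<Rightarrow> nat \<Rightarrow> nat \<Rightarrow> nat \<Rightarrow> nat \<Rightarrow> bool" where
  "simplicial_RDS G H A m n k \<Lambda> \<longleftrightarrow>
     is_RDS G H A m n k \<Lambda> \<and>
     bij_betw (\<lambda>a. H #>\<^bsub>G\<^esub> a) A ((rcosets\<^bsub>G\<^esub> H) - {H})"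


section \<open>Fine and composite difference sets\<close>

text \<open>If \<open>D\<close> is all of \<open>G\<close> then the denominator below vanishes and this number is 0 in HOL. This
  is harmless: \<open>fine_difference_set\<close> would then require \<open>H\<close> to have order $|G|$ and to be disjoint
  from \<open>D\<close>, which is impossible.\<close>

definition S_param :: "('g, 'x) monoid_scheme \<Rightarrow> 'g set \<Rightarrow> real" where
  "S_param G D =
     sqrt (real (card D) * (real (order G) - 1) / (real (order G) - real (card D)))"

definition fine_difference_set :: "('g, 'x) monoid_scheme \<Rightarrow> 'g set \<Rightarrow> 'g set \<Rightarrow> bool" where
  "fine_difference_set G H D \<longleftrightarrow>
     difference_set G D \<and> D \<noteq> {} \<and> subgroup H G \<and> D \<inter> H = {} \<and>
     real (card H) = real (order G) / (S_param G D + 1)"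

definition convolution ::
  "('g, 'x) monoid_scheme \<Rightarrow> ('g \<Rightarrow> real) \<Rightarrow> ('g \<Rightarrow> real) \<Rightarrow> 'g \<Rightarrow> real" where
  "convolution G f1 f2 g = (\<Sum>g' \<in> carrier G. f1 g' * f2 (g \<otimes>\<^bsub>G\<^esub> inv\<^bsub>G\<^esub> g'))"

definition composite_with ::
  "('g, 'x) monoid_scheme \<Rightarrow> 'g set \<Rightarrow> 'g set \<Rightarrow> 'g set \<Rightarrow> 'g set \<Rightarrow> bool" where
  "composite_with G H D A B \<longleftrightarrow>
     fine_difference_set G H D \<and>
     A \<subseteq> carrier G \<and> real (card A) = S_param G D \<and>
     difference_set (G\<lparr>carrier := H\<rparr>) B \<and>
     (\<forall>g \<in> carrier G. indicator D g = convolution G (indicator A) (indicator B) g)"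

definition composite_difference_set :: "('g, 'x) monoid_scheme \<Rightarrow> 'g set \<Rightarrow> bool" where
  "composite_difference_set G D \<longleftrightarrow> (\<exists>H A B. composite_with G H D A B)"


section \<open>Finite fields and Singer difference sets\<close>

definition finite_field_of_order :: "('a, 'x) ring_scheme \<Rightarrow> nat \<Rightarrow> bool" where
  "finite_field_of_order R q \<longleftrightarrow> field R \<and> finite (carrier R) \<and> card (carrier R) = q"

text \<open>A subfield of order \<open>q\<close> of a finite field is unique, so a set \<open>F\<close> with
  \<open>finite_subfield_of_order F R q\<close> is "the" copy of $\mathbb{F}_q$ inside \<open>R\<close>.\<close>

definition finite_subfield_of_order :: "'a set \<Rightarrow> ('a, 'x) ring_scheme \<Rightarrow> nat \<Rightarrow> bool" where
  "finite_subfield_of_order F R q \<longleftrightarrow> subfield F R \<and> finite F \<and> card F = q"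

text \<open>The group of units of \<open>F\<close>, as a subset of \<open>R\<close>, for a subfield \<open>F\<close>.\<close>

definition nonzero_elts :: "('a, 'x) ring_scheme \<Rightarrow> 'a set \<Rightarrow> 'a set" where
  "nonzero_elts R F = F - {\<zero>\<^bsub>R\<^esub>}"

text \<open>The quotient of the multiplicative group of \<open>R\<close> by that of the subfield \<open>F\<close>; its elements are
  the cosets of \<open>nonzero_elts R F\<close>.\<close>

definition unit_quotient :: "('a, 'x) ring_scheme \<Rightarrow> 'a set \<Rightarrow> 'a set monoid" where
  "unit_quotient R F = mult_of R Mod nonzero_elts R F"

definition bar :: "('a, 'x) ring_scheme \<Rightarrow> 'a set \<Rightarrow> 'a \<Rightarrow> 'a set" where
  "bar R F x = nonzero_elts R F #>\<^bsub>mult_of R\<^esub> x"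

text \<open>The trace from the field \<open>R\<close> of order $Q^n$ to its subfield of order \<open>Q\<close>.\<close>

definition field_trace :: "('a, 'x) ring_scheme \<Rightarrow> nat \<Rightarrow> nat \<Rightarrow> 'a \<Rightarrow> 'a" where
  "field_trace R Q n x = finsum R (\<lambda>j. x [^]\<^bsub>R\<^esub> (Q ^ j)) {..<n}"

text \<open>The complement of the Singer difference set for \<open>unit_quotient R F\<close>, where \<open>R\<close> has order
  $Q^n$ and \<open>F\<close> has order \<open>Q\<close>. Whether the trace vanishes does not depend on the representative
  of a coset, as the trace is \<open>F\<close>-linear.\<close>

definition singer_complement :: "('a, 'x) ring_scheme \<Rightarrow> 'a set \<Rightarrow> nat \<Rightarrow> nat \<Rightarrow> 'a set set" where
  "singer_complement R F Q n =
     {bar R F x | x. x \<in> carrier (mult_of R) \<and> field_trace R Q n x \<noteq> \<zero>\<^bsub>R\<^esub>}"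

definition classical_RDS :: "('a, 'x) ring_scheme \<Rightarrow> nat \<Rightarrow> 'a set" where
  "classical_RDS R Q = {x \<in> carrier (mult_of R). x \<oplus>\<^bsub>R\<^esub> x [^]\<^bsub>R\<^esub> Q = \<one>\<^bsub>R\<^esub>}"

end

theory Submission
  imports Defs
begin

text \<open>
  Let $E$ be the set of $x \in \mathbb{F}_{Q^2}$ of trace 1. For $g \notin \mathbb{F}_Q$ the linear map
  $b \mapsto (\mathrm{tr}\,b, \mathrm{tr}\,(gb))$ is onto $\mathbb{F}_Q^2$, so exactly one $b$ has
  $b, gb \in E$; for $g \in \mathbb{F}_Q$ linearity forces $g = 1$. The only coset of
  $\mathbb{F}_Q^\times$ missed by $E$ consists of the nonzero $t$ with $\mathrm{tr}\,t = 0$, so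
  $t^{-1} E$ is simplicial. Surjectivity of the same map (for any degree) shows that the
  complement of the Singer set is a difference set.

  For the second part apply this with $Q^J$ in place of $Q$. As the trace to $\mathbb{F}_Q$ factors
  through $T = \mathrm{tr}_{Q^{2J}/Q^J}$, an element $y$ of nonzero trace is $T(y) \cdot y/T(y)$, with
  $y/T(y)$ of $T$-trace 1 and $T(y) \in \mathbb{F}_{Q^J}$ of nonzero trace. Dividing by $t$ with
  $T(t) = 0$ and passing to cosets of $\mathbb{F}_Q^\times$ gives the factorization.
\<close>

section \<open>Polynomials and Frobenius in finite domains\<close>

text \<open>Induction on \<open>n\<close>: Pascal's rule splits each term of degree
  \<open>Suc n\<close> into \<open>x\<close> times one and \<open>y\<close> times another term of
  degree \<open>n\<close>, and the two resulting sums recombine by distributivity.\<close>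

lemma (in cring) binomial_expansion:
  assumes x: "x \<in> carrier R" and y: "y \<in> carrier R"
  shows "(x \<oplus> y) [^] (n::nat) = (\<Oplus>k\<in>{..n}. [(n choose k)] \<cdot> (x [^] k \<otimes> y [^] (n - k)))"
proof (induction n)
  case 0
  then show ?case by simp
next
  case (Suc n)
  define t where "t n k = [(n choose k)] \<cdot> (x [^] k \<otimes> y [^] (n - k))" for n k :: nat
  have t_closed [simp]: "t n k \<in> carrier R" for n k
    by (simp add: t_def x y)
  have t0: "t (Suc n) 0 = y \<otimes> t n 0"
    using x y by (simp add: t_def m_comm)
  \<comment> \<open>The case \<open>k = n\<close> is separate because \<open>n - Suc k\<close>
    truncates there; both sides are then zero, since \<open>n choose Suc n\<close> vanishes.\<close>
  have pow_y: "[(n choose Suc k)] \<cdot> (x [^] Suc k \<otimes> y [^] (n - k)) = y \<otimes> t n (Suc k)" if "k \<le> n" for k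
  proof (cases "k = n")
    case False
    let ?m = "n - Suc k"
    have "n - k = Suc ?m" using False that by simp
    then have "x [^] Suc k \<otimes> y [^] (n - k) = x [^] Suc k \<otimes> (y [^] ?m \<otimes> y)"
      by (simp only: nat_pow_Suc)
    also have "\<dots> = y \<otimes> (x [^] Suc k \<otimes> y [^] ?m)"
      using x y by (simp only: m_ac nat_pow_closed m_closed)
    finally show ?thesis
      using x y by (simp add: t_def add_pow_rdistr del: nat_pow_Suc)
  qed (simp add: t_def x y binomial_eq_0)
  have tS: "t (Suc n) (Suc k) = x \<otimes> t n k \<oplus> y \<otimes> t n (Suc k)" if "k \<le> n" for k
  proof -
    have "t (Suc n) (Suc k) = [(n choose k)] \<cdot> (x [^] Suc k \<otimes> y [^] (n - k))
        \<oplus> [(n choose Suc k)] \<cdot> (x [^] Suc k \<otimes> y [^] (n - k))"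
      using x y by (simp add: t_def add.nat_pow_mult)
    also have "[(n choose k)] \<cdot> (x [^] Suc k \<otimes> y [^] (n - k)) = x \<otimes> t n k"
    proof -
      have "x [^] Suc k \<otimes> y [^] (n - k) = x \<otimes> (x [^] k \<otimes> y [^] (n - k))"
        using x y by (simp only: nat_pow_Suc m_ac nat_pow_closed m_closed)
      then show ?thesis
        using x y by (simp add: t_def add_pow_rdistr del: nat_pow_Suc)
    qed
    finally show ?thesis using pow_y[OF that] by simp
  qed
  have "(\<Oplus>k\<in>{..Suc n}. t (Suc n) k) = (\<Oplus>k\<in>{..n}. x \<otimes> t n k \<oplus> y \<otimes> t n (Suc k)) \<oplus> y \<otimes> t n 0"
    using x y by (subst finsum_Suc2) (auto simp: t0 tS cong: finsum_cong)
  also have "\<dots> = (\<Oplus>k\<in>{..n}. x \<otimes> t n k) \<oplus> ((\<Oplus>k\<in>{..n}. y \<otimes> t n (Suc k)) \<oplus> y \<otimes> t n 0)"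
    using x y by (subst finsum_addf) (auto simp: a_assoc)
  also have "(\<Oplus>k\<in>{..n}. y \<otimes> t n (Suc k)) \<oplus> y \<otimes> t n 0 = (\<Oplus>k\<in>{..Suc n}. y \<otimes> t n k)"
    using x y by (subst finsum_Suc2) auto
  also have "\<dots> = (\<Oplus>k\<in>{..n}. y \<otimes> t n k)"
    using x y by (subst finsum_Suc) (auto simp: t_def binomial_eq_0)
  also have "(\<Oplus>k\<in>{..n}. x \<otimes> t n k) = x \<otimes> (\<Oplus>k\<in>{..n}. t n k)"
    using x y by (subst finsum_rdistr) auto
  also have "(\<Oplus>k\<in>{..n}. y \<otimes> t n k) = y \<otimes> (\<Oplus>k\<in>{..n}. t n k)"
    using x y by (subst finsum_rdistr) auto
  also have "(\<Oplus>k\<in>{..n}. t n k) = (x \<oplus> y) [^] n"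
    using Suc by (simp add: t_def)
  also have "x \<otimes> (x \<oplus> y) [^] n \<oplus> y \<otimes> (x \<oplus> y) [^] n = (x \<oplus> y) [^] Suc n"
    using x y by (simp add: l_distr r_distr m_comm)
  finally show ?case by (simp add: t_def)
qed

lemma (in cring) add_pow_eq_zero_of_dvd:
  assumes "[(p::nat)] \<cdot> \<one> = \<zero>" "p dvd m" "x \<in> carrier R"
  shows "[m] \<cdot> x = \<zero>"
proof -
  obtain j where m: "m = p * j" using assms(2) by blast
  have "[m] \<cdot> x = [j] \<cdot> ([p] \<cdot> x)"
    using assms by (simp add: m add.nat_pow_pow mult.commute)
  also have "[p] \<cdot> x = [p] \<cdot> \<one> \<otimes> x"
    using assms(3) by (simp add: add_pow_ldistr)
  finally show ?thesis
    using assms by simp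
qed

text \<open>The binomial coefficients strictly between the ends are divisible by \<open>p\<close>,
  so only the two outer terms of the \<open>p\<close>-th power survive in characteristic
  \<open>p\<close>; exponents \<open>p ^ k\<close> follow by iteration.\<close>

lemma (in cring) frobenius_add:
  assumes p: "prime (p::nat)" "[p] \<cdot> \<one> = \<zero>" and x: "x \<in> carrier R" and y: "y \<in> carrier R"
  shows "(x \<oplus> y) [^] (p ^ k) = x [^] (p ^ k) \<oplus> y [^] (p ^ k)"
proof (induction k)
  case (Suc k)
  have step: "(u \<oplus> v) [^] p = u [^] p \<oplus> v [^] p" if u: "u \<in> carrier R" and v: "v \<in> carrier R" for u v
  proof -
    let ?t = "\<lambda>k. [(p choose k)] \<cdot> (u [^] k \<otimes> v [^] (p - k))"
    have p0: "p > 0" using p prime_gt_0_nat by blast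
    have mid: "?t k = \<zero>" if "0 < k" "k < p" for k
    proof (rule add_pow_eq_zero_of_dvd[OF p(2)])
      show "p dvd (p choose k)"
        by (rule dvd_choose_prime) (use that p0 p(1) in auto)
    qed (simp add: u v)
    have "(u \<oplus> v) [^] p = (\<Oplus>k\<in>{..p}. ?t k)"
      using u v by (rule binomial_expansion)
    also have "{..p} = insert 0 (insert p {0<..<p})"
      using p0 by auto
    also have "(\<Oplus>k\<in>\<dots>. ?t k) = ?t 0 \<oplus> (?t p \<oplus> (\<Oplus>k\<in>{0<..<p}. ?t k))"
      using p0 u v by (subst finsum_insert) (auto simp: finsum_insert)
    also have "(\<Oplus>k\<in>{0<..<p}. ?t k) = (\<Oplus>k\<in>{0<..<p}. \<zero>)"
      by (rule finsum_cong') (use mid in auto)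
    finally show ?thesis
      using u v by (simp add: a_comm finsum_zero)
  qed
  have pp: "w [^] (p ^ Suc k) = (w [^] (p ^ k)) [^] p" if "w \<in> carrier R" for w
    using that by (simp add: nat_pow_pow mult.commute)
  show ?case
    using Suc step x y by (simp add: pp del: power_Suc)
qed (use x y in simp)


section \<open>Characteristic and roots in a finite domain\<close>

text \<open>The additive group has order \<open>p ^ m\<close>, hence \<open>p ^ m\<close> times
  \<open>\<one>\<close> is zero. This multiple is a product of \<open>m\<close> copies of
  \<open>p\<close> times \<open>\<one>\<close>, so one factor must vanish.\<close>

lemma (in domain) finite_domain_char:
  assumes "finite (carrier R)" "prime (p::nat)" "card (carrier R) = p ^ m"
  shows "[p] \<cdot> \<one> = \<zero>"
proof -
  have "[(p ^ m)] \<cdot> \<one> = \<zero>"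
    using add.pow_order_eq_1[of \<one>] assms by (simp add: order_def)
  then show ?thesis
  proof (induction m)
    case (Suc m)
    have "[(p ^ Suc m)] \<cdot> \<one> = [p] \<cdot> (\<one> \<otimes> ([(p ^ m)] \<cdot> \<one>))"
      by (simp add: add.nat_pow_pow mult.commute)
    also have "\<dots> = [p] \<cdot> \<one> \<otimes> [(p ^ m)] \<cdot> \<one>"
      by (subst add_pow_ldistr) auto
    finally show ?case
      using Suc integral by auto
  qed simp
qed

text \<open>Transfers the root bound for \<open>UP R\<close> to an explicit sum of powers, the form
  in which the trace is later treated as a polynomial.\<close>

lemma (in domain) card_roots_le:
  fixes c :: "nat \<Rightarrow> 'a"
  assumes fin: "finite (carrier R)" and c: "\<And>i. i \<le> d \<Longrightarrow> c i \<in> carrier R" and lead: "c d \<noteq> \<zero>"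
  shows "card {a \<in> carrier R. (\<Oplus>i\<in>{..d}. c i \<otimes> a [^] i) = \<zero>} \<le> d"
proof -
  interpret P: UP_domain R "UP R" by unfold_locales
  define f where "f = (\<lambda>i. if i \<le> d then c i else \<zero>)"
  have f: "f \<in> carrier (UP R)"
    unfolding UP_def f_def using c by (auto simp: up_def bound_def intro!: exI[of _ d])
  have coeff: "coeff (UP R) f i = (if i \<le> d then c i else \<zero>)" for i
    using f by (simp add: UP_def f_def)
  have deg: "deg R f = d"
    by (intro antisym P.deg_aboveI P.deg_belowI f) (use lead in \<open>auto simp: coeff\<close>)
  have "f \<noteq> \<zero>\<^bsub>UP R\<^esub>"
    using lead P.coeff_zero[of d] coeff[of d] by auto
  from P.roots_bound[OF f this fin]
  have "card {a \<in> carrier R. eval R R id a f = \<zero>} \<le> d"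
    by (simp add: deg)
  moreover have "eval R R id a f = (\<Oplus>i\<in>{..d}. c i \<otimes> a [^] i)" if "a \<in> carrier R" for a
    using f that unfolding eval_def
    by (auto simp: deg coeff c intro!: finsum_cong')
  ultimately show ?thesis
    by (smt (verit) Collect_cong)
qed

section \<open>Difference sets and quotients\<close>

context group
begin

text \<open>A pair with quotient \<open>g\<close> is determined by its second entry
  \<open>b\<close>, the first being \<open>g \<otimes> b\<close>.\<close>

lemma diff_count_eq_card:
  assumes D: "D \<subseteq> carrier G" and g: "g \<in> carrier G"
  shows "diff_count G D g = card {b \<in> D. g \<otimes> b \<in> D}"
proof -
  have eq: "{(a, b). a \<in> D \<and> b \<in> D \<and> a \<otimes> inv b = g} = (\<lambda>b. (g \<otimes> b, b)) ` {b \<in> D. g \<otimes> b \<in> D}"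
    using D g inv_solve_right' by (auto 0 3 simp: image_iff subset_iff m_assoc)
  show ?thesis
    unfolding diff_count_def eq by (rule card_image) (auto simp: inj_on_def)
qed

lemma r_coset_eq_iff:
  assumes N: "subgroup N G" and x: "x \<in> carrier G" and y: "y \<in> carrier G"
  shows "N #> x = N #> y \<longleftrightarrow> (\<exists>f\<in>N. x = f \<otimes> y)"
proof
  assume "N #> x = N #> y"
  then have "x \<in> N #> y" using rcos_self[OF x N] by simp
  then show "\<exists>f\<in>N. x = f \<otimes> y" by (auto simp: r_coset_def)
next
  assume "\<exists>f\<in>N. x = f \<otimes> y"
  then have "x \<in> N #> y" by (auto simp: r_coset_def)
  then show "N #> x = N #> y"
    using repr_independence[OF _ y N] by simp
qed

lemma card_l_coset:
  assumes "c \<in> carrier G" "A \<subseteq> carrier G"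
  shows "card (c <# A) = card A"
proof -
  have "c <# A = (\<lambda>a. c \<otimes> a) ` A" by (auto simp: l_coset_def)
  then show ?thesis
    using assms by (auto simp: inj_on_def subset_iff intro!: card_image)
qed

text \<open>A set stable under \<open>N\<close> is a disjoint union of cosets, each of size
  \<open>card N\<close>.\<close>

lemma card_eq_card_cosets_times:
  assumes N: "subgroup N G" and Y: "Y \<subseteq> carrier G" "finite Y"
    and stable: "\<And>f y. f \<in> N \<Longrightarrow> y \<in> Y \<Longrightarrow> f \<otimes> y \<in> Y"
  shows "card Y = card ((\<lambda>y. N #> y) ` Y) * card N"
proof -
  let ?P = "(\<lambda>y. N #> y) ` Y"
  have P: "?P \<subseteq> rcosets N"
    using Y by (auto simp: RCOSETS_def)
  have U: "\<Union>?P = Y"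
  proof
    show "Y \<subseteq> \<Union>?P" using Y rcos_self[OF _ N] by blast
  qed (use stable in \<open>auto simp: r_coset_def\<close>)
  have "card N * card ?P = card (\<Union>?P)"
  proof (rule card_partition)
    show "card c = card N" if "c \<in> ?P" for c
      using that P N by (metis card_rcosets_equal subgroup.subset subsetD)
    show "c1 \<inter> c2 = {}" if "c1 \<in> ?P" "c2 \<in> ?P" "c1 \<noteq> c2" for c1 c2
      using that P rcos_disjoint[OF N] by (auto simp: pairwise_def disjnt_def)
  qed (use Y U in auto)
  then show ?thesis using U by (simp add: mult.commute)
qed

end

section \<open>Shifts and simplicial relative difference sets\<close>

context comm_group
begin

text \<open>In a commutative group the factor \<open>c\<close> cancels from every quotient, so
  shifting by \<open>c\<close> carries solutions to solutions bijectively.\<close>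

lemma diff_count_l_coset:
  assumes c: "c \<in> carrier G" and D: "D \<subseteq> carrier G" and g: "g \<in> carrier G"
  shows "diff_count G (c <# D) g = diff_count G D g"
proof -
  have cD: "c <# D \<subseteq> carrier G" by (rule l_coset_subset_G[OF D c])
  have "{b \<in> c <# D. g \<otimes> b \<in> c <# D} = c <# {b \<in> D. g \<otimes> b \<in> D}"
    using c D g by (auto 0 3 simp: l_coset_def subset_iff m_lcomm[of g c])
  then show ?thesis
    using card_l_coset[OF c, of "{b \<in> D. g \<otimes> b \<in> D}"] D
    by (auto simp: diff_count_eq_card[OF cD g] diff_count_eq_card[OF D g])
qed

lemma difference_set_l_coset:
  assumes D: "difference_set G D" and c: "c \<in> carrier G"
  shows "difference_set G (c <# D)"
proof -
  have sub: "D \<subseteq> carrier G" using D by (simp add: difference_set_def)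
  show ?thesis
    using D l_coset_subset_G[OF sub c]
    by (simp add: difference_set_def diff_count_l_coset[OF c sub])
qed

lemma is_RDS_l_coset:
  assumes A: "is_RDS G H A m n k \<Lambda>" and c: "c \<in> carrier G"
  shows "is_RDS G H (c <# A) m n k \<Lambda>"
proof -
  have sub: "A \<subseteq> carrier G" "H \<subseteq> carrier G"
    using A by (auto simp: is_RDS_def subgroup.subset)
  show ?thesis
    using A l_coset_subset_G[OF sub(1) c] sub
    by (auto simp: is_RDS_def diff_count_l_coset[OF c sub(1)] card_l_coset[OF c sub(1)] subset_iff)
qed

text \<open>Two elements of \<open>A\<close> in one coset of \<open>N\<close> have their quotient in
  \<open>H\<close>, and the only such quotient is \<open>\<one>\<close>.\<close>

lemma inj_on_coset_of_is_RDS: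
  assumes A: "is_RDS G H A m n k \<Lambda>" and N: "subgroup N G" "N \<subseteq> H"
  shows "inj_on (\<lambda>a. N #> a) A"
proof (rule inj_onI)
  fix a b assume ab: "a \<in> A" "b \<in> A" "N #> a = N #> b"
  have sub: "A \<subseteq> carrier G" and fin: "finite A" and H: "subgroup H G"
    using A finite_subset by (auto simp: is_RDS_def)
  then have Hc: "H \<subseteq> carrier G" by (simp add: subgroup.subset)
  obtain f where f: "f \<in> N" "a = f \<otimes> b"
    using ab N r_coset_eq_iff[of N a b] sub by blast
  have "b \<in> {b \<in> A. f \<otimes> b \<in> A}" using ab f by auto
  then have "diff_count G A f \<noteq> 0"
    using diff_count_eq_card[OF sub, of f] subgroup.mem_carrier[OF N(1) f(1)] fin by auto
  moreover have "\<forall>h \<in> H - {\<one>}. diff_count G A h = 0"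
    using A by (simp add: is_RDS_def)
  ultimately have "f = \<one>" using subsetD[OF N(2) f(1)] by (metis Diff_iff singletonD)
  then show "a = b" using f ab sub by auto
qed

text \<open>The \<open>k\<close> elements of \<open>A\<close> lie in distinct cosets, none of them
  \<open>H\<close> by disjointness. There are exactly \<open>k\<close> cosets besides
  \<open>H\<close>, so all of them are met.\<close>

lemma simplicial_RDS_of_is_RDS:
  assumes A: "is_RDS G H A (k + 1) n k \<Lambda>" and disj: "A \<inter> H = {}"
  shows "simplicial_RDS G H A (k + 1) n k \<Lambda>"
proof -
  have H: "subgroup H G" and fin: "finite (carrier G)" and sub: "A \<subseteq> carrier G"
    and card: "order G = (k + 1) * n" "card H = n" "card A = k"
    using A by (auto simp: is_RDS_def)
  have finH: "finite H" using H fin subgroup.subset finite_subset by blast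
  then have n: "n > 0" using card H subgroup.one_closed by (metis card_gt_0_iff empty_iff)
  have "card (rcosets H) * n = (k + 1) * n"
    using lagrange[OF H] card by simp
  then have cr: "card (rcosets H) = k + 1" using n by (subst (asm) mult_cancel2) simp
  have HH: "H \<in> rcosets H" by (rule subgroup.subgroup_in_rcosets[OF H is_group])
  have finr: "finite (rcosets H)" using cr card_ge_0_finite by force
  have inj: "inj_on (\<lambda>a. H #> a) A"
    by (rule inj_on_coset_of_is_RDS[OF A H order_refl])
  have "(\<lambda>a. H #> a) ` A \<subseteq> rcosets H - {H}"
  proof
    fix X assume "X \<in> (\<lambda>a. H #> a) ` A"
    then obtain a where a: "a \<in> A" "X = H #> a" by blast
    then have "a \<in> X" "a \<notin> H" using rcos_self[OF _ H] sub disj by auto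
    then show "X \<in> rcosets H - {H}" using a sub by (auto simp: RCOSETS_def)
  qed
  moreover have "card ((\<lambda>a. H #> a) ` A) = card (rcosets H - {H})"
    using card_image[OF inj] card cr HH by simp
  ultimately have "(\<lambda>a. H #> a) ` A = rcosets H - {H}"
    using finr by (simp add: card_subset_eq)
  with A inj show ?thesis
    by (simp add: simplicial_RDS_def bij_betw_def)
qed

section \<open>Difference counts in quotient groups\<close>

context
  fixes N assumes N: "subgroup N G"
begin

lemma r_coset_mult:
  assumes "x \<in> carrier G" "y \<in> carrier G"
  shows "(N #> x) \<otimes>\<^bsub>G Mod N\<^esub> (N #> y) = N #> (x \<otimes> y)"
  using normal.rcos_sum[OF subgroup_imp_normal[OF N]] assms by simp

lemma comm_group_quotient: "comm_group (G Mod N)"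
  by (rule abelian_FactGroup[OF N])

lemma r_coset_in_quotient: "x \<in> carrier G \<Longrightarrow> N #> x \<in> carrier (G Mod N)"
  by (simp add: carrier_FactGroup)

text \<open>For a union of cosets, the solutions in \<open>G\<close> again form a union of cosets of
  \<open>N\<close>, and these cosets are the solutions in the quotient. This is the case of the
  Singer complement.\<close>

lemma card_quotient_diff_count_stable:
  assumes Y: "Y \<subseteq> carrier G" "finite Y"
    and stable: "\<And>f y. f \<in> N \<Longrightarrow> y \<in> Y \<Longrightarrow> f \<otimes> y \<in> Y" and g: "g \<in> carrier G"
  shows "diff_count (G Mod N) ((\<lambda>y. N #> y) ` Y) (N #> g) * card N = card {y \<in> Y. g \<otimes> y \<in> Y}"
proof -
  interpret Q: comm_group "G Mod N" by (rule comm_group_quotient)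
  have Nc: "f \<in> N \<Longrightarrow> f \<in> carrier G" for f using N subgroup.mem_carrier by metis
  let ?p = "\<lambda>y. N #> y"
  have mem: "?p y \<in> ?p ` Y \<longleftrightarrow> y \<in> Y" if y: "y \<in> carrier G" for y
    using r_coset_eq_iff[OF N y] stable Y by (metis (no_types, lifting) image_iff subsetD)
  have "?p g \<otimes>\<^bsub>G Mod N\<^esub> ?p y \<in> ?p ` Y \<longleftrightarrow> g \<otimes> y \<in> Y" if "y \<in> Y" for y
    using that Y g mem[of "g \<otimes> y"] by (subst r_coset_mult) auto
  then have "{b \<in> ?p ` Y. ?p g \<otimes>\<^bsub>G Mod N\<^esub> b \<in> ?p ` Y} = ?p ` {y \<in> Y. g \<otimes> y \<in> Y}"
    by blast
  then have "diff_count (G Mod N) (?p ` Y) (?p g) = card (?p ` {y \<in> Y. g \<otimes> y \<in> Y})"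
    using Y g by (subst Q.diff_count_eq_card) (auto intro: r_coset_in_quotient)
  moreover have "card {y \<in> Y. g \<otimes> y \<in> Y} = card (?p ` {y \<in> Y. g \<otimes> y \<in> Y}) * card N"
  proof (rule card_eq_card_cosets_times[OF N])
    show "f \<otimes> y \<in> {y \<in> Y. g \<otimes> y \<in> Y}" if "f \<in> N" "y \<in> {y \<in> Y. g \<otimes> y \<in> Y}" for f y
      using that stable[of f "g \<otimes> y"] stable[of f y] g Y Nc[of f]
      by (auto simp: subset_iff m_lcomm)
  qed (use Y in auto)
  ultimately show ?thesis by simp
qed

text \<open>This is the opposite case, where \<open>E\<close> meets each coset at most once: a
  solution for the coset of \<open>g\<close> is a solution for \<open>f \<otimes> g\<close> with
  exactly one \<open>f\<close> in \<open>N\<close>, so the counts add up over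
  \<open>N\<close>.\<close>

lemma diff_count_quotient_inj:
  assumes E: "E \<subseteq> carrier G" "finite E" and inj: "inj_on (\<lambda>y. N #> y) E" and g: "g \<in> carrier G"
    and N_fin: "finite N" and count: "\<And>f. f \<in> N \<Longrightarrow> diff_count G E (f \<otimes> g) = \<Lambda>"
  shows "diff_count (G Mod N) ((\<lambda>y. N #> y) ` E) (N #> g) = card N * \<Lambda>"
proof -
  interpret Q: comm_group "G Mod N" by (rule comm_group_quotient)
  have Nc: "f \<in> N \<Longrightarrow> f \<in> carrier G" for f using N subgroup.mem_carrier by metis
  let ?p = "\<lambda>y. N #> y"
  let ?Z = "\<lambda>f. {y \<in> E. (f \<otimes> g) \<otimes> y \<in> E}"
  have mem: "?p g \<otimes>\<^bsub>G Mod N\<^esub> ?p y \<in> ?p ` E \<longleftrightarrow> (\<exists>f\<in>N. (f \<otimes> g) \<otimes> y \<in> E)" if y: "y \<in> E" for y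
  proof -
    have yc: "y \<in> carrier G" "g \<otimes> y \<in> carrier G" using y E g by auto
    have "?p (g \<otimes> y) \<in> ?p ` E \<longleftrightarrow> (\<exists>z\<in>E. \<exists>f\<in>N. z = f \<otimes> (g \<otimes> y))"
    proof -
      have "?p (g \<otimes> y) \<in> ?p ` E \<longleftrightarrow> (\<exists>z\<in>E. ?p z = ?p (g \<otimes> y))" by (metis (lifting) image_iff)
      also have "\<dots> \<longleftrightarrow> (\<exists>z\<in>E. \<exists>f\<in>N. z = f \<otimes> (g \<otimes> y))"
        using E by (intro bex_cong refl r_coset_eq_iff[OF N _ yc(2)]) auto
      finally show ?thesis .
    qed
    moreover have "(f \<otimes> g) \<otimes> y = f \<otimes> (g \<otimes> y)" if "f \<in> N" for f
      using yc g Nc[OF that] by (simp add: m_assoc)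
    ultimately show ?thesis using r_coset_mult[OF g yc(1)] by auto
  qed
  have "{y \<in> E. ?p g \<otimes>\<^bsub>G Mod N\<^esub> ?p y \<in> ?p ` E} = (\<Union>f\<in>N. ?Z f)"
  proof (rule Set.set_eqI)
    fix y
    show "y \<in> {y \<in> E. ?p g \<otimes>\<^bsub>G Mod N\<^esub> ?p y \<in> ?p ` E} \<longleftrightarrow> y \<in> (\<Union>f\<in>N. ?Z f)"
      by (cases "y \<in> E") (simp_all add: mem del: mult_FactGroup)
  qed
  then have "{b \<in> ?p ` E. ?p g \<otimes>\<^bsub>G Mod N\<^esub> b \<in> ?p ` E} = ?p ` (\<Union>f\<in>N. ?Z f)"
    unfolding Compr_image_eq by (rule arg_cong)
  then have "diff_count (G Mod N) (?p ` E) (?p g) = card (?p ` (\<Union>f\<in>N. ?Z f))"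
    using E g by (subst Q.diff_count_eq_card) (auto intro: r_coset_in_quotient)
  also have "\<dots> = card (\<Union>f\<in>N. ?Z f)"
    by (rule card_image, rule inj_on_subset[OF inj]) auto
  also have "\<dots> = (\<Sum>f\<in>N. card (?Z f))"
  \<comment> \<open>A common \<open>y\<close> for \<open>f\<close> and \<open>f'\<close> would give
    two elements of \<open>E\<close> in the coset of \<open>g \<otimes> y\<close>; injectivity makes
    them equal, which forces \<open>f = f'\<close>.\<close>
  proof (rule card_UN_disjoint[OF N_fin]; intro ballI impI)
    fix f f' assume ff: "f \<in> N" "f' \<in> N" "f \<noteq> f'"
    show "?Z f \<inter> ?Z f' = {}"
    proof (rule ccontr)
      assume "?Z f \<inter> ?Z f' \<noteq> {}"
      then obtain y where y: "y \<in> E" "(f \<otimes> g) \<otimes> y \<in> E" "(f' \<otimes> g) \<otimes> y \<in> E" by blast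
      have c: "y \<in> carrier G" "f \<in> carrier G" "f' \<in> carrier G" "g \<otimes> y \<in> carrier G"
        using y E Nc ff g by auto
      have "?p ((f \<otimes> g) \<otimes> y) = ?p (g \<otimes> y)" "?p ((f' \<otimes> g) \<otimes> y) = ?p (g \<otimes> y)"
        using c g ff by (subst r_coset_eq_iff[OF N]; auto simp: m_assoc)+
      then have "(f \<otimes> g) \<otimes> y = (f' \<otimes> g) \<otimes> y"
        using inj y by (metis (no_types, lifting) inj_onD)
      then show False using c g ff by simp
    qed
  qed (use E in auto)
  also have "\<dots> = (\<Sum>f\<in>N. \<Lambda>)"
    by (rule sum.cong) (use diff_count_eq_card[OF E(1)] count g Nc in auto)
  finally show ?thesis by simp
qed

text \<open>The classes \<open>f \<otimes> x\<close> with \<open>f\<close> in \<open>N\<close> all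
  avoid \<open>M\<close> if \<open>x\<close> does, and all lie in \<open>M - {\<one>}\<close> if
  \<open>x\<close> lies in \<open>M\<close> but not in \<open>N\<close>. Hence the preceding count
  applies with the constant \<open>\<Lambda>\<close> in the first case and \<open>0\<close> in the
  second.\<close>

lemma is_RDS_quotient:
  assumes E: "is_RDS G M E m n k \<Lambda>" and NM: "N \<subseteq> M"
  shows "is_RDS (G Mod N) ((\<lambda>x. N #> x) ` M) ((\<lambda>x. N #> x) ` E) m (n div card N) k (card N * \<Lambda>)"
proof -
  let ?p = "\<lambda>x. N #> x"
  have M: "subgroup M G" and fin: "finite (carrier G)" and sub: "E \<subseteq> carrier G"
    and card: "order G = m * n" "card M = n" "card E = k"
    and d0: "\<And>h. h \<in> M - {\<one>} \<Longrightarrow> diff_count G E h = 0"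
    and dL: "\<And>g. g \<in> carrier G - M \<Longrightarrow> diff_count G E g = \<Lambda>"
    using E by (auto simp: is_RDS_def)
  have Mc: "M \<subseteq> carrier G" using M by (simp add: subgroup.subset)
  have finN: "finite N" using NM Mc fin by (meson finite_subset)
  have cN: "card N > 0" using finN N subgroup.one_closed card_gt_0_iff by blast
  have inj: "inj_on ?p E" by (rule inj_on_coset_of_is_RDS[OF E N NM])
  have finE: "finite E" using sub fin finite_subset by blast
  note Nc = subgroup.mem_carrier[OF N]
  have "card M = card (?p ` M) * card N"
    by (rule card_eq_card_cosets_times[OF N Mc]) (use Mc fin finite_subset M NM in \<open>auto intro: subgroup.m_closed\<close>)
  then have cM: "card (?p ` M) * card N = n" using card by simp
  have "order G = card (?p ` carrier G) * card N"
    unfolding order_def by (rule card_eq_card_cosets_times[OF N]) (use fin Nc in auto)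
  then have "order (G Mod N) * card N = m * card (?p ` M) * card N"
    using card cM by (simp add: order_def carrier_FactGroup)
  then have oM: "order (G Mod N) = m * card (?p ` M)" using cN by simp
  have pM: "card (?p ` M) = n div card N" using cM cN by (metis div_mult_self_is_m)
  have hom: "group_hom G (G Mod N) ?p"
    using normal.r_coset_hom_Mod[OF subgroup_imp_normal[OF N]] comm_group_quotient
    by (simp add: group_hom_def group_hom_axioms_def comm_group_def is_group)
  have sg: "subgroup (?p ` M) (G Mod N)"
    by (rule group_hom.subgroup_img_is_subgroup[OF hom M])
  have z: "diff_count (G Mod N) (?p ` E) h = 0" if h: "h \<in> ?p ` M - {N}" for h
  proof -
    obtain x where x: "x \<in> M" "h = ?p x" using h by blast
    have "f \<otimes> x \<in> M - {\<one>}" if f: "f \<in> N" for f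
    proof -
      have "f \<otimes> x \<noteq> \<one>"
      proof
        assume "f \<otimes> x = \<one>"
        then have "x = inv f" using x f Nc Mc by (metis inv_equality inv_inv subsetD)
        then have "x \<in> N" using f N subgroup.m_inv_closed by metis
        then show False using x h N coset_join2 Mc by blast
      qed
      then show ?thesis using f x NM M subgroup.m_closed by fastforce
    qed
    then show ?thesis
      using diff_count_quotient_inj[OF sub finE inj, of x 0] d0 x Mc finN by auto
  qed
  have l: "diff_count (G Mod N) (?p ` E) h = card N * \<Lambda>" if h: "h \<in> carrier (G Mod N) - ?p ` M" for h
  proof -
    obtain x where x: "x \<in> carrier G" "x \<notin> M" "h = ?p x"
      using h by (auto simp: carrier_FactGroup)
    have "f \<otimes> x \<in> carrier G - M" if f: "f \<in> N" for f
    proof -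
      have "f \<otimes> x \<notin> M"
      proof
        assume "f \<otimes> x \<in> M"
        then have "inv f \<otimes> (f \<otimes> x) \<in> M"
          using f NM M by (meson subgroup.m_closed subgroup.m_inv_closed subsetD)
        then show False using x f Nc by (simp add: m_assoc[symmetric])
      qed
      then show ?thesis using x f Nc by auto
    qed
    then show ?thesis
      using diff_count_quotient_inj[OF sub finE inj, of x \<Lambda>] dL x finN by auto
  qed
  show ?thesis
    unfolding is_RDS_def
    using comm_group_quotient fin sg sub oM pM card z l card_image[OF inj]
    by (auto simp: carrier_FactGroup)
qed

end

end

section \<open>The trace of a finite field extension\<close>

lemma (in field) subfield_pow_card:
  assumes M: "subfield M R" "finite M" and x: "x \<in> M"
  shows "x [^] card M = x"
proof (cases "x = \<zero>")
  case True
  then show ?thesis using M x nat_pow_zero[of "card M"] by auto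
next
  case False
  interpret M: field "R\<lparr>carrier := M\<rparr>" by (rule subfield_iff(2)[OF M(1)])
  interpret MG: group "mult_of (R\<lparr>carrier := M\<rparr>)" by (rule M.field_mult_group)
  have "x [^]\<^bsub>R\<lparr>carrier := M\<rparr>\<^esub> (card M - 1) = \<one>"
    using MG.pow_order_eq_1[of x] M x False M.zero_closed
    by (simp add: order_def nat_pow_mult_of card_Diff_singleton)
  then have "x [^] (card M - 1) = \<one>"
    by (simp add: nat_pow_def)
  moreover have "card M = Suc (card M - 1)"
    using M x card_gt_0_iff[of M] by auto
  ultimately show ?thesis
    using subfieldE(3)[OF M(1)] x by (metis l_one nat_pow_Suc subsetD)
qed

text \<open>The nonzero elements of \<open>M\<close> are already \<open>card M - 1\<close> roots of
  the equation \<open>y [^] (card M - 1) = \<one>\<close>, the largest possible number, so there are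
  no further ones.\<close>

lemma (in field) mem_subfield_iff_pow_card:
  assumes fin: "finite (carrier R)" and M: "subfield M R" and x: "x \<in> carrier R"
  shows "x \<in> M \<longleftrightarrow> x [^] card M = x"
proof
  have Mc: "M \<subseteq> carrier R" by (rule subfieldE(3)[OF M])
  have finM: "finite M" using Mc fin finite_subset by blast
  have zo: "\<zero> \<in> M" "\<one> \<in> M" using subringE[OF subfieldE(1)[OF M]] by auto
  have c: "card M = Suc (card M - 1)" "card M - 1 \<noteq> 0"
    using card_mono[OF finM, of "{\<zero>, \<one>}"] zo by auto
  have canc: "y [^] (card M - 1) = \<one>" if "y \<in> carrier R - {\<zero>}" "y [^] card M = y" for y
  proof -
    have "y [^] (card M - 1) \<otimes> y = \<one> \<otimes> y"
      using that c(1) by (metis Diff_iff l_one nat_pow_Suc)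
    then show ?thesis using that m_rcancel by (metis Diff_iff nat_pow_closed one_closed singletonI)
  qed
  have sub: "M - {\<zero>} \<subseteq> {y \<in> carrier R. y [^] (card M - 1) = \<one>}"
    using canc Mc subfield_pow_card[OF M finM] by auto
  have "M - {\<zero>} = {y \<in> carrier R. y [^] (card M - 1) = \<one>}"
    by (rule card_seteq[OF _ sub])
      (use fin num_roots_le_deg[OF fin c(2)] zo finM in \<open>auto simp: card_Diff_singleton\<close>)
  then show "x \<in> M" if "x [^] card M = x"
    using canc[of x] zo x that by (cases "x = \<zero>") auto
  show "x [^] card M = x" if "x \<in> M"
    using subfield_pow_card[OF M finM that] .
qed

text \<open>The ring is left arbitrary so that the rule serves both a field and its restriction to a
  subfield.\<close>

lemma finsum_lessThan_Suc:
  assumes "abelian_monoid R" "f \<in> {..<Suc m} \<rightarrow> carrier R"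
  shows "finsum R f {..<Suc m} = f m \<oplus>\<^bsub>R\<^esub> finsum R f {..<m}"
proof -
  interpret abelian_monoid R by fact
  show ?thesis
    using assms(2) unfolding lessThan_Suc by (subst finsum_insert) auto
qed

text \<open>The trace is a polynomial of degree \<open>q ^ (n - 1)\<close> in \<open>x\<close>, with
  coefficient \<open>\<one>\<close> at the exponents \<open>q ^ j\<close> and zero
  elsewhere.\<close>

lemma (in field) card_trace_zeros_le:
  assumes fin: "finite (carrier R)" and q: "q > 1" and n: "n > 0"
  shows "card {x \<in> carrier R. field_trace R q n x = \<zero>} \<le> q ^ (n - 1)"
proof -
  let ?S = "(\<lambda>j. q ^ j) ` {..<n}"
  define c where "c i = (if i \<in> ?S then \<one> else \<zero>)" for i
  have le: "q ^ j \<le> q ^ (n - 1)" if "j < n" for j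
    using that q by (intro power_increasing) auto
  have inj: "inj_on (\<lambda>j. q ^ j) {..<n}"
    using q by (auto simp: inj_on_def)
  have "(\<Oplus>i\<in>{..q ^ (n - 1)}. c i \<otimes> x [^] i) = field_trace R q n x" if x: "x \<in> carrier R" for x
  proof -
    have "(\<Oplus>i\<in>{..q ^ (n - 1)}. c i \<otimes> x [^] i) = (\<Oplus>i\<in>?S. x [^] i)"
      by (rule add.finprod_mono_neutral_cong_right[symmetric, THEN sym])
        (use x le in \<open>auto simp: c_def\<close>)
    also have "\<dots> = field_trace R q n x"
      unfolding field_trace_def by (rule finsum_reindex[OF _ inj]) (use x in auto)
    finally show ?thesis .
  qed
  moreover have "card {x \<in> carrier R. (\<Oplus>i\<in>{..q ^ (n - 1)}. c i \<otimes> x [^] i) = \<zero>} \<le> q ^ (n - 1)"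
    by (rule card_roots_le[OF fin]) (use n in \<open>auto simp: c_def\<close>)
  ultimately show ?thesis by (simp cong: conj_cong)
qed

section \<open>Linearity and surjectivity of the trace\<close>

text \<open>The base field is a subset of the large one and the degree \<open>n\<close> enters
  through cardinalities, so that every step of a tower of fields is an instance.\<close>

locale finite_field_ext = field R for R (structure) +
  fixes F and q n :: nat
  assumes fin: "finite (carrier R)" and subF: "subfield F R" and card_F: "card F = q"
    and card_R: "card (carrier R) = q ^ n" and q: "primepow q"
begin

abbreviation "tr \<equiv> field_trace R q n"

lemma F_carrier: "f \<in> F \<Longrightarrow> f \<in> carrier R"
  using subfieldE(3)[OF subF] by blast

lemma finF: "finite F"
  using fin subfieldE(3)[OF subF] finite_subset by blast

lemma F_closed:
  "\<zero> \<in> F" "\<one> \<in> F" "a \<in> F \<Longrightarrow> b \<in> F \<Longrightarrow> a \<oplus> b \<in> F" "a \<in> F \<Longrightarrow> b \<in> F \<Longrightarrow> a \<otimes> b \<in> F"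
  "a \<in> F \<Longrightarrow> \<ominus> a \<in> F" "a \<in> F \<Longrightarrow> b \<in> F \<Longrightarrow> a \<ominus> b \<in> F"
  "a \<in> F \<Longrightarrow> a \<noteq> \<zero> \<Longrightarrow> inv a \<in> F"
  using subringE[OF subfieldE(1)[OF subF]] subfield_m_inv[OF subF] by (auto simp: a_minus_def)

lemma q_gt_1: "q > 1"
  using q by (rule primepow_gt_Suc_0[unfolded One_nat_def[symmetric]])

lemma n_pos: "n > 0"
proof (rule ccontr)
  assume "\<not> n > 0"
  then have "card (carrier R) = 1" using card_R by simp
  then show False
    using card_mono[OF fin, of "{\<zero>, \<one>}"] by simp
qed

lemma frob_add:
  assumes "x \<in> carrier R" "y \<in> carrier R"
  shows "(x \<oplus> y) [^] (q ^ j) = x [^] (q ^ j) \<oplus> y [^] (q ^ j)"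
proof -
  obtain p k where p: "prime p" "q = p ^ k"
    using q by (auto simp: primepow_def)
  have "[p] \<cdot> \<one> = \<zero>"
    using finite_domain_char[OF fin p(1), of "k * n"] card_R p by (simp add: power_mult)
  then show ?thesis
    using frobenius_add[OF p(1) _ assms, of "k * j"] p by (simp add: power_mult)
qed

lemma frob_finsum:
  assumes "f \<in> {..<m::nat} \<rightarrow> carrier R"
  shows "(\<Oplus>j\<in>{..<m}. f j) [^] (q ^ i) = (\<Oplus>j\<in>{..<m}. f j [^] (q ^ i))"
  using assms
proof (induction m)
  case 0
  \<comment> \<open>The empty sum is zero, and its power is zero only for a positive
    exponent.\<close>
  have "q ^ i \<noteq> 0" using q_gt_1 by simp
  then show ?case by (simp add: nat_pow_zero del: power_eq_0_iff)
next
  case (Suc m)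
  have f: "f \<in> {..<m} \<rightarrow> carrier R" "f m \<in> carrier R" using Suc by auto
  have "finsum R f {..<m} \<in> carrier R" using f by (intro finsum_closed) auto
  moreover have "(\<Oplus>j\<in>{..<Suc m}. f j [^] (q ^ i)) = f m [^] (q ^ i) \<oplus> (\<Oplus>j\<in>{..<m}. f j [^] (q ^ i))"
    by (rule finsum_lessThan_Suc[OF abelian_monoid_axioms]) (use Suc.prems in auto)
  ultimately show ?case
    using Suc f by (simp add: finsum_lessThan_Suc[OF abelian_monoid_axioms] frob_add)
qed

lemma F_pow:
  assumes "f \<in> F"
  shows "f [^] (q ^ j) = f"
proof (induction j)
  case (Suc j)
  have "f [^] (q ^ Suc j) = (f [^] (q ^ j)) [^] q"
    using F_carrier[OF assms] by (simp add: nat_pow_pow mult.commute)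
  then show ?case
    using Suc subfield_pow_card[OF subF finF assms] card_F by simp
qed (simp add: assms F_carrier)

lemma tr_closed [simp]: "x \<in> carrier R \<Longrightarrow> tr x \<in> carrier R"
  unfolding field_trace_def by (intro finsum_closed) auto

lemma tr_zero [simp]: "tr \<zero> = \<zero>"
proof -
  have "\<zero> [^] (q ^ j) = \<zero>" for j
    using q_gt_1 nat_pow_zero[of "q ^ j"] by simp
  then show ?thesis unfolding field_trace_def by (simp add: finsum_zero)
qed

lemma tr_add:
  assumes "x \<in> carrier R" "y \<in> carrier R"
  shows "tr (x \<oplus> y) = tr x \<oplus> tr y"
  unfolding field_trace_def using assms
  by (subst finsum_addf[symmetric]) (auto simp: frob_add intro!: finsum_cong')

lemma tr_mult:
  assumes "f \<in> F" "x \<in> carrier R"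
  shows "tr (f \<otimes> x) = f \<otimes> tr x"
  unfolding field_trace_def using assms F_carrier[of f]
  by (subst finsum_rdistr) (auto simp: nat_pow_distrib F_pow intro!: finsum_cong')

text \<open>Raising to the power \<open>q\<close> permutes the summands of the trace cyclically,
  because \<open>x [^] (q ^ n) = x\<close>. The trace is thus a fixed point of this power map, and
  the fixed points form \<open>F\<close>.\<close>

lemma tr_in_F:
  assumes x: "x \<in> carrier R"
  shows "tr x \<in> F"
proof -
  let ?f = "\<lambda>j. x [^] (q ^ j)"
  have top: "?f n = ?f 0"
    using subfield_pow_card[OF carrier_is_subfield fin x] card_R x by simp
  have "tr x [^] q = (\<Oplus>j\<in>{..<n}. ?f j [^] q)"
    using frob_finsum[of ?f n 1] x by (simp add: field_trace_def)
  also have "\<dots> = (\<Oplus>j\<in>{..<n}. ?f (Suc j))"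
    using x by (auto simp: nat_pow_pow mult.commute intro!: finsum_cong')
  also have "\<dots> = tr x"
  proof -
    obtain m where m: "n = Suc m" using n_pos by (cases n) auto
    \<comment> \<open>Removing the last term on the left and the first on the right leaves equal
      sums; \<open>top\<close> identifies the removed terms.\<close>
    have "(\<Oplus>j\<in>{..m}. ?f (Suc j)) = (\<Oplus>j\<in>{..m}. ?f j)"
    proof (cases m)
      case (Suc k)
      have "(\<Oplus>j\<in>{..m}. ?f (Suc j)) = ?f n \<oplus> (\<Oplus>j\<in>{..k}. ?f (Suc j))"
        unfolding Suc m using x by (subst finsum_Suc) (auto simp: Suc)
      also have "\<dots> = (\<Oplus>j\<in>{..k}. ?f (Suc j)) \<oplus> ?f 0"
        unfolding top using x by (intro a_comm finsum_closed) auto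
      also have "\<dots> = (\<Oplus>j\<in>{..m}. ?f j)"
        unfolding Suc using x by (subst finsum_Suc2) auto
      finally show ?thesis .
    qed (use top m x in auto)
    then show ?thesis by (simp add: field_trace_def m lessThan_Suc_atMost)
  qed
  finally show ?thesis
    using mem_subfield_iff_pow_card[OF fin subF, of "tr x"] x card_F by simp
qed

lemma tr_uminus: "x \<in> carrier R \<Longrightarrow> tr (\<ominus> x) = \<ominus> tr x"
  using tr_add[of "\<ominus> x" x] by (simp add: minus_equality l_neg)

lemma tr_minus: "x \<in> carrier R \<Longrightarrow> y \<in> carrier R \<Longrightarrow> tr (x \<ominus> y) = tr x \<ominus> tr y"
  by (simp add: a_minus_def tr_add tr_uminus)

text \<open>By linearity it suffices to divide by the nonzero trace. The last equation is recorded
  so that a vanishing \<open>tr e\<close> survives the scaling.\<close>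

lemma ex_tr_one_scaling:
  assumes "e \<in> carrier R" "h \<in> carrier R" "tr (h \<otimes> e) \<noteq> \<zero>"
  obtains f where "f \<in> F" "tr (h \<otimes> (f \<otimes> e)) = \<one>" "tr (f \<otimes> e) = f \<otimes> tr e"
proof
  let ?f = "inv (tr (h \<otimes> e))"
  show f: "?f \<in> F" using assms by (intro F_closed tr_in_F) auto
  have "h \<otimes> (?f \<otimes> e) = ?f \<otimes> (h \<otimes> e)"
    using assms F_carrier[OF f] by (intro m_lcomm) auto
  then show "tr (h \<otimes> (?f \<otimes> e)) = \<one>"
    using assms tr_mult[OF f, of "h \<otimes> e"] by (simp add: field_Units)
  show "tr (?f \<otimes> e) = ?f \<otimes> tr e" using f assms by (intro tr_mult)
qed

text \<open>The trace has at most \<open>q ^ (n - 1)\<close> zeros, fewer than there are field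
  elements; a nonzero value is then scaled to \<open>\<one>\<close>.\<close>

lemma ex_tr_one: obtains e where "e \<in> carrier R" "tr e = \<one>"
proof -
  have "q ^ (n - 1) < q ^ n" using q_gt_1 n_pos by (intro power_strict_increasing) auto
  then have "{x \<in> carrier R. tr x = \<zero>} \<noteq> carrier R"
    using card_trace_zeros_le[OF fin q_gt_1 n_pos] card_R by auto
  then obtain x where x: "x \<in> carrier R" "tr x \<noteq> \<zero>" by auto
  then obtain f where "f \<in> F" "tr (\<one> \<otimes> (f \<otimes> x)) = \<one>"
    using ex_tr_one_scaling[of x \<one>] by auto
  then show ?thesis using that[of "f \<otimes> x"] x F_carrier by simp
qed

text \<open>If \<open>tr (g \<otimes> b)\<close> vanished on the whole kernel of the trace, it would
  be a fixed multiple \<open>f \<otimes> tr b\<close>. Then \<open>g \<ominus> f\<close>, nonzero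
  since \<open>g\<close> is not in \<open>F\<close>, would multiply every element into that kernel,
  although its multiples include an element of trace one.\<close>

lemma ex_tr_zero_one:
  assumes g: "g \<in> carrier R" "g \<notin> F"
  obtains e where "e \<in> carrier R" "tr e = \<zero>" "tr (g \<otimes> e) = \<one>"
proof -
  have "\<exists>b\<in>carrier R. tr b = \<zero> \<and> tr (g \<otimes> b) \<noteq> \<zero>"
  proof (rule ccontr)
    assume "\<not> ?thesis"
    then have H: "tr (g \<otimes> b) = \<zero>" if "b \<in> carrier R" "tr b = \<zero>" for b using that by blast
    obtain b0 where b0: "b0 \<in> carrier R" "tr b0 = \<one>" using ex_tr_one .
    define f where "f = tr (g \<otimes> b0)"
    have f: "f \<in> F" "f \<in> carrier R" using g b0 by (auto simp: f_def intro: tr_in_F)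
    define d where "d = g \<ominus> f"
    have d: "d \<in> carrier R" "d \<noteq> \<zero>" using f g by (auto simp: d_def)
    have z: "tr (d \<otimes> b) = \<zero>" if b: "b \<in> carrier R" for b
    proof -
      \<comment> \<open>This is the projection of \<open>b\<close> to the kernel of the trace along
        \<open>b0\<close>.\<close>
      define u where "u = b \<ominus> tr b \<otimes> b0"
      have u: "u \<in> carrier R" using b b0 by (simp add: u_def)
      have "tr u = \<zero>" using b b0 by (simp add: u_def tr_minus tr_mult tr_in_F)
      then have "tr (g \<otimes> u) = \<zero>" using H u by simp
      moreover have "g \<otimes> u = g \<otimes> b \<ominus> tr b \<otimes> (g \<otimes> b0)"
        using b b0 g unfolding u_def by (simp add: r_distr a_minus_def r_minus m_lcomm)
      ultimately have "tr (g \<otimes> b) = tr b \<otimes> f"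
        using b b0 g by (simp add: tr_minus tr_mult tr_in_F f_def)
      moreover have "d \<otimes> b = g \<otimes> b \<ominus> f \<otimes> b"
        using b g f unfolding d_def by (simp add: l_distr a_minus_def l_minus)
      ultimately show ?thesis
        using b f g by (simp add: tr_minus tr_mult m_comm[of "tr b" f])
    qed
    have "inv d \<in> carrier R" "d \<otimes> inv d = \<one>" using d by (auto simp: field_Units)
    then have "d \<otimes> (inv d \<otimes> b0) = b0" using d b0 by (simp add: m_assoc[symmetric])
    then show False using z[of "inv d \<otimes> b0"] b0 \<open>inv d \<in> carrier R\<close> by simp
  qed
  then obtain b where b: "b \<in> carrier R" "tr b = \<zero>" "tr (g \<otimes> b) \<noteq> \<zero>" by blast
  obtain f where f: "f \<in> F" "tr (g \<otimes> (f \<otimes> b)) = \<one>" "tr (f \<otimes> b) = f \<otimes> tr b"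
    using ex_tr_one_scaling[OF b(1) g(1) b(3)] .
  show ?thesis
    using that[of "f \<otimes> b"] f b F_carrier[OF f(1)] by simp
qed

text \<open>Translation by multiples of \<open>e\<close> permutes the fibers of \<open>h\<close> simply transitively.\<close>

lemma card_fiber:
  assumes V: "V \<subseteq> carrier R" and h: "\<And>v. v \<in> V \<Longrightarrow> h v \<in> F" and e: "e \<in> carrier R"
    and shift: "\<And>v f. v \<in> V \<Longrightarrow> f \<in> F \<Longrightarrow> v \<oplus> f \<otimes> e \<in> V"
    and h_shift: "\<And>v f. v \<in> V \<Longrightarrow> f \<in> F \<Longrightarrow> h (v \<oplus> f \<otimes> e) = h v \<oplus> f"
    and s: "s \<in> F"
  shows "card V = q * card {v \<in> V. h v = s}"
proof -
  let ?g = "\<lambda>(f, v). v \<oplus> f \<otimes> e"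
  let ?W = "{v \<in> V. h v = s}"
  have sc: "s \<in> carrier R" using s F_carrier by simp
  have inj: "inj_on ?g (F \<times> ?W)"
  proof (rule inj_onI, clarsimp)
    fix f v f' v'
    assume *: "f \<in> F" "v \<in> V" "f' \<in> F" "v' \<in> V" "h v' = h v" "v \<oplus> f \<otimes> e = v' \<oplus> f' \<otimes> e" "s = h v"
    have c: "f \<in> carrier R" "f' \<in> carrier R" "h v \<in> carrier R" "v \<in> carrier R" "v' \<in> carrier R"
      using * F_carrier h V by auto
    have "h v \<oplus> f = h v \<oplus> f'"
      using * h_shift by metis
    then have "f = f'"
      using c by (simp add: a_comm[of "h v"])
    moreover from this have "v = v'"
      using *(6) add.right_cancel[of "f \<otimes> e" v v'] c e by blast
    ultimately show "f = f' \<and> v = v'" by simp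
  qed
  have img: "?g ` (F \<times> ?W) = V"
  proof
    show "V \<subseteq> ?g ` (F \<times> ?W)"
    proof
      fix w assume w: "w \<in> V"
      \<comment> \<open>This is the offset of \<open>w\<close> from the fiber over \<open>s\<close>:
        translating by \<open>\<ominus> f\<close> times \<open>e\<close> moves \<open>w\<close> into
        it.\<close>
      define f where "f = h w \<ominus> s"
      have f: "f \<in> F" "\<ominus> f \<in> F" "f \<in> carrier R" "w \<in> carrier R" "h w \<in> carrier R"
        using h[OF w] s w V F_carrier by (auto simp: f_def F_closed)
      have "w \<oplus> (\<ominus> f) \<otimes> e \<in> ?W"
        using shift[OF w f(2)] h_shift[OF w f(2)] f sc
        by (simp add: f_def minus_add a_minus_def a_assoc[symmetric] r_neg)
      moreover have "w = (w \<oplus> (\<ominus> f) \<otimes> e) \<oplus> f \<otimes> e"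
        using f e by (simp add: a_assoc l_minus l_neg)
      ultimately show "w \<in> ?g ` (F \<times> ?W)" using f(1) by force
    qed
  qed (use shift in auto)
  show ?thesis using card_image[OF inj, unfolded img] by (simp add: card_cartesian_product card_F)
qed

section \<open>Fibers of the trace\<close>

lemma card_tr_fiber:
  assumes s: "s \<in> F"
  shows "card {x \<in> carrier R. tr x = s} = q ^ (n - 1)"
proof -
  obtain e where e: "e \<in> carrier R" "tr e = \<one>" using ex_tr_one .
  have "card (carrier R) = q * card {x \<in> carrier R. tr x = s}"
    by (rule card_fiber[OF _ _ e(1) _ _ s])
      (use e F_carrier in \<open>auto simp: tr_in_F tr_add tr_mult\<close>)
  moreover have "q ^ n = q * q ^ (n - 1)" using n_pos by (cases n) auto
  ultimately show ?thesis using card_R q_gt_1 by simp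
qed

lemma card_tr_nonzero: "card {x \<in> carrier R. tr x \<noteq> \<zero>} = (q - 1) * q ^ (n - 1)"
proof -
  have "{x \<in> carrier R. tr x \<noteq> \<zero>} = carrier R - {x \<in> carrier R. tr x = \<zero>}" by auto
  moreover have "q ^ n = q * q ^ (n - 1)" using n_pos by (cases n) auto
  ultimately show ?thesis
    using fin card_R card_tr_fiber[OF F_closed(1)]
    by (simp add: card_Diff_subset diff_mult_distrib)
qed

text \<open>Translating by multiples of an \<open>e\<close> with \<open>tr e = \<zero>\<close> and
  \<open>tr (g \<otimes> e) = \<one>\<close> keeps the first trace and shifts the second, whose
  values are therefore equidistributed. The set \<open>S\<close> will be \<open>{\<one>}\<close> for
  the relative difference set and the complement of \<open>{\<zero>}\<close> for the Singer
  set.\<close>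

lemma card_tr_pair_fiber:
  assumes g: "g \<in> carrier R" "g \<notin> F" and s: "s \<in> F"
  shows "card {x \<in> carrier R. tr x \<in> S} = q * card {x \<in> carrier R. tr x \<in> S \<and> tr (g \<otimes> x) = s}"
proof -
  obtain e where e: "e \<in> carrier R" "tr e = \<zero>" "tr (g \<otimes> e) = \<one>" using ex_tr_zero_one[OF g] .
  have "card {x \<in> carrier R. tr x \<in> S} = q * card {x \<in> {x \<in> carrier R. tr x \<in> S}. tr (g \<otimes> x) = s}"
  proof (rule card_fiber[OF _ _ e(1) _ _ s])
    fix v f assume v: "v \<in> {x \<in> carrier R. tr x \<in> S}" and f: "f \<in> F"
    have fc: "f \<in> carrier R" using f F_carrier by simp
    show "v \<oplus> f \<otimes> e \<in> {x \<in> carrier R. tr x \<in> S}"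
      using v f fc e by (simp add: tr_add tr_mult)
    have "g \<otimes> (v \<oplus> f \<otimes> e) = g \<otimes> v \<oplus> f \<otimes> (g \<otimes> e)"
      using v fc e g by (simp add: r_distr m_lcomm)
    then show "tr (g \<otimes> (v \<oplus> f \<otimes> e)) = tr (g \<otimes> v) \<oplus> f"
      using v f fc e g by (simp add: tr_add tr_mult)
  qed (use g in \<open>auto intro: tr_in_F\<close>)
  then show ?thesis by (simp add: conj_assoc)
qed

end

section \<open>Trace-one sets and Singer complements\<close>

context comm_group
begin

text \<open>At \<open>g\<close> the convolution counts the factorizations
  \<open>g = a \<otimes> b\<close>: one if \<open>g\<close> lies in \<open>D\<close> and none
  otherwise.\<close>

lemma indicator_eq_convolution:
  assumes A: "A \<subseteq> carrier G" and B: "B \<subseteq> carrier G" and fin: "finite (carrier G)"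
    and bij: "bij_betw (\<lambda>(a, b). a \<otimes> b) (A \<times> B) D" and g: "g \<in> carrier G"
  shows "indicator D g = convolution G (indicator A) (indicator B) g"
proof -
  let ?W = "{a \<in> A. g \<otimes> inv a \<in> B}"
  have finA: "finite A" using A fin finite_subset by blast
  have split: "a \<otimes> b = g \<longleftrightarrow> b = g \<otimes> inv a" if "a \<in> A" "b \<in> carrier G" for a b
  proof -
    have "b = g \<otimes> inv a \<longleftrightarrow> g = b \<otimes> a"
      using that A g by (intro inv_solve_right) auto
    moreover have "b \<otimes> a = a \<otimes> b"
      using that A by (intro m_comm) auto
    ultimately show ?thesis by metis
  qed
  have "convolution G (indicator A) (indicator B) g
      = (\<Sum>a\<in>?W. 1)"
    unfolding convolution_def
    by (rule sum.mono_neutral_cong_right) (use fin A in \<open>auto simp: indicator_def\<close>)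
  also have "\<dots> = real (card ?W)" by simp
  also have "\<dots> = indicator D g"
  proof (cases "g \<in> D")
    case True
    then obtain a b where ab: "a \<in> A" "b \<in> B" "g = a \<otimes> b"
      using bij by (auto simp: bij_betw_def image_iff)
    have "?W = {a}"
    proof
      show "{a} \<subseteq> ?W" using ab split[of a b] B by auto
      show "?W \<subseteq> {a}"
      proof
        fix c assume c: "c \<in> ?W"
        then have "c \<otimes> (g \<otimes> inv c) = g" using split[of c "g \<otimes> inv c"] B by auto
        then have "(\<lambda>(a, b). a \<otimes> b) (c, g \<otimes> inv c) = (\<lambda>(a, b). a \<otimes> b) (a, b)"
          using ab(3) by simp
        then have "(c, g \<otimes> inv c) = (a, b)"
          by (rule inj_onD[OF bij_betw_imp_inj_on[OF bij]]) (use c ab in auto)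
        then show "c \<in> {a}" by simp
      qed
    qed
    then show ?thesis using True by simp
  next
    case False
    have "?W = {}"
    proof (rule ccontr)
      assume "?W \<noteq> {}"
      then obtain c where c: "c \<in> A" "g \<otimes> inv c \<in> B" by blast
      then have "c \<otimes> (g \<otimes> inv c) = g" using split[of c "g \<otimes> inv c"] B by auto
      moreover have "c \<otimes> (g \<otimes> inv c) \<in> D"
        using bij_betw_apply[OF bij, of "(c, g \<otimes> inv c)"] c by simp
      ultimately show False using False by simp
    qed
    then have "card ?W = 0" by (simp only: card.empty)
    then show ?thesis using False by simp
  qed
  finally show ?thesis by simp
qed

text \<open>The coset \<open>H #> (a \<otimes> b) = H #> a\<close> determines \<open>a\<close>, so the products are distinct; as there are
  \<open>card D\<close> of them they exhaust \<open>D\<close>.\<close>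

lemma composite_with_of_simplicial:
  assumes A: "simplicial_RDS G H A (k + 1) n k \<Lambda>"
    and B: "difference_set (G\<lparr>carrier := H\<rparr>) B" and D: "difference_set G D" "D \<noteq> {}"
    and AB: "\<And>a b. a \<in> A \<Longrightarrow> b \<in> B \<Longrightarrow> a \<otimes> b \<in> D" and card: "card D = k * card B"
    and S: "S_param G D = real k"
  shows "composite_with G H D A B"
proof -
  have H: "subgroup H G" and fin: "finite (carrier G)" and Ac: "A \<subseteq> carrier G"
    and cards: "order G = (k + 1) * n" "card H = n" "card A = k"
    using A by (auto simp: simplicial_RDS_def is_RDS_def)
  note Hc = subgroup.mem_carrier[OF H]
  have BH: "B \<subseteq> H" using B by (simp add: difference_set_def)
  have Bc: "B \<subseteq> carrier G" using BH Hc by blast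
  have Dc: "D \<subseteq> carrier G" using D by (simp add: difference_set_def)
  have inj: "inj_on (\<lambda>a. H #> a) A" and img: "(\<lambda>a. H #> a) ` A = rcosets H - {H}"
    using A by (auto simp: simplicial_RDS_def bij_betw_def)
  have absorb: "H #> (x \<otimes> y) = H #> x" if "x \<in> carrier G" "y \<in> H" for x y
    using that Hc by (subst r_coset_eq_iff[OF H]) (auto intro!: bexI[of _ y] m_comm)
  have inj2: "inj_on (\<lambda>(a, b). a \<otimes> b) (A \<times> B)"
  proof (rule inj_onI, clarify)
    fix a b a' b' assume *: "a \<in> A" "b \<in> B" "a' \<in> A" "b' \<in> B" "a \<otimes> b = a' \<otimes> b'"
    have c: "a \<in> carrier G" "a' \<in> carrier G" "b \<in> carrier G" "b' \<in> carrier G"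
      using * Ac Bc by auto
    have "H #> (a \<otimes> b) = H #> a" "H #> (a' \<otimes> b') = H #> a'"
      using absorb[of a b] absorb[of a' b'] c * BH by blast+
    then have "H #> a = H #> a'" using *(5) by metis
    then have "a = a'" using inj_onD[OF inj] * by blast
    then show "a = a' \<and> b = b'" using * c by simp
  qed
  have "(\<lambda>(a, b). a \<otimes> b) ` (A \<times> B) = D"
  proof (rule card_subset_eq)
    show "finite D" using Dc fin finite_subset by blast
    show "card ((\<lambda>(a, b). a \<otimes> b) ` (A \<times> B)) = card D"
      using card_image[OF inj2] cards card by (simp add: card_cartesian_product)
  qed (use AB in auto)
  with inj2 have bij: "bij_betw (\<lambda>(a, b). a \<otimes> b) (A \<times> B) D"
    by (simp add: bij_betw_def)
  \<comment> \<open>If \<open>a \<otimes> b\<close> were in \<open>H\<close>, then so would be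
    \<open>a\<close>, as \<open>b\<close> is; but the simplicial set \<open>A\<close> does not
    represent the coset \<open>H\<close>.\<close>
  have "D \<inter> H = {}"
  proof (rule ccontr)
    assume "D \<inter> H \<noteq> {}"
    then obtain a b where ab: "a \<in> A" "b \<in> B" "a \<otimes> b \<in> H"
      using bij by (auto simp: bij_betw_def)
    then have c: "a \<in> carrier G" "b \<in> H" "b \<in> carrier G" using Ac BH Bc by auto
    have "(a \<otimes> b) \<otimes> inv b \<in> H"
      using ab c H by (metis subgroup.m_closed subgroup.m_inv_closed)
    then have "a \<in> H" using c by (simp add: m_assoc)
    then have "H #> a = H" using c H coset_join2 by blast
    then show False using img ab by blast
  qed
  moreover have "real (card H) = real (order G) / (S_param G D + 1)"
    using cards S by (simp add: field_simps)
  ultimately show ?thesis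
    unfolding composite_with_def fine_difference_set_def
    using D H Ac B S cards indicator_eq_convolution[OF Ac Bc fin bij] by auto
qed

end

section \<open>The unit group and its quotient by the base field\<close>

context finite_field_ext
begin

abbreviation "U \<equiv> mult_of R"
abbreviation "N \<equiv> nonzero_elts R F"

lemma comm_group_mult_of: "comm_group U"
  by (rule group.group_comm_groupI[OF field_mult_group]) (auto simp: m_comm)

lemma subgroup_N: "subgroup N U"
  unfolding nonzero_elts_def by (rule subgroup_mult_of[OF subF])

lemma card_N: "card N = q - 1"
  using F_closed card_F finF by (simp add: nonzero_elts_def card_Diff_singleton)

lemma order_U: "order U = q ^ n - 1"
  using order_mult_of[OF fin] card_R by (simp add: order_def)

lemma singer_complement_eq:
  "singer_complement R F q n = (\<lambda>x. N #>\<^bsub>U\<^esub> x) ` {x \<in> carrier R. tr x \<noteq> \<zero>}"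
proof -
  have "{x. x \<in> carrier U \<and> tr x \<noteq> \<zero>} = {x \<in> carrier R. tr x \<noteq> \<zero>}" by auto
  then show ?thesis
    unfolding singer_complement_def bar_def setcompr_eq_image by (rule arg_cong)
qed

lemma tr_nonzero_stable:
  "f \<in> N \<Longrightarrow> y \<in> {x \<in> carrier R. tr x \<noteq> \<zero>} \<Longrightarrow> f \<otimes>\<^bsub>U\<^esub> y \<in> {x \<in> carrier R. tr x \<noteq> \<zero>}"
  using F_carrier by (auto simp: nonzero_elts_def tr_mult integral_iff)

lemma card_singer_complement: "card (singer_complement R F q n) = q ^ (n - 1)"
proof -
  interpret U: comm_group U by (rule comm_group_mult_of)
  have "card {x \<in> carrier R. tr x \<noteq> \<zero>} = card (singer_complement R F q n) * card N"
    unfolding singer_complement_eq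
    by (rule U.card_eq_card_cosets_times[OF subgroup_N]) (use fin tr_nonzero_stable in auto)
  then show ?thesis
    using card_tr_nonzero card_N q_gt_1 by simp
qed

text \<open>For \<open>g\<close> outside \<open>F\<close>, one in \<open>q\<close> of the elements
  \<open>x\<close> of nonzero trace has \<open>tr (g \<otimes> x) = \<zero>\<close>. The number of
  \<open>x\<close> with both traces nonzero is thus independent of \<open>g\<close>, and dividing by
  \<open>card N\<close> counts cosets.\<close>

lemma difference_set_singer_complement:
  "difference_set (unit_quotient R F) (singer_complement R F q n)"
proof -
  interpret U: comm_group U by (rule comm_group_mult_of)
  let ?Y = "{x \<in> carrier R. tr x \<noteq> \<zero>}"
  have Y: "?Y \<subseteq> carrier U" "finite ?Y" using fin by auto
  have "diff_count (unit_quotient R F) (singer_complement R F q n) X = (card ?Y - card ?Y div q) div (q - 1)"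
    if X: "X \<in> carrier (unit_quotient R F) - {\<one>\<^bsub>unit_quotient R F\<^esub>}" for X
  proof -
    obtain g where g: "g \<in> carrier U" "X = N #>\<^bsub>U\<^esub> g" "X \<noteq> N"
      using X by (auto simp: unit_quotient_def carrier_FactGroup)
    have gF: "g \<notin> F"
    proof
      assume "g \<in> F"
      then have "g \<in> N" using g by (simp add: nonzero_elts_def)
      then show False using g U.coset_join2[OF _ subgroup_N] by auto
    qed
    have gR: "g \<in> carrier R" using g by simp
    let ?Z = "{x \<in> carrier R. tr x \<in> - {\<zero>} \<and> tr (g \<otimes> x) = \<zero>}"
    have "card ?Y = q * card ?Z"
      using card_tr_pair_fiber[OF gR gF F_closed(1), of "- {\<zero>}"] by simp
    then have Z: "card ?Z = card ?Y div q" using q_gt_1 by simp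
    have "{y \<in> ?Y. g \<otimes>\<^bsub>U\<^esub> y \<in> ?Y} = ?Y - ?Z" using gR by auto
    then have "card {y \<in> ?Y. g \<otimes>\<^bsub>U\<^esub> y \<in> ?Y} = card ?Y - card ?Z"
      using fin by (auto simp: card_Diff_subset subset_iff)
    then have "diff_count (unit_quotient R F) (singer_complement R F q n) X * (q - 1) = card ?Y - card ?Y div q"
      using U.card_quotient_diff_count_stable[OF subgroup_N Y tr_nonzero_stable g(1)] Z g(2)
      by (simp add: unit_quotient_def singer_complement_eq card_N)
    then show ?thesis using q_gt_1 by (metis div_mult_self_is_m zero_less_diff)
  qed
  moreover have "singer_complement R F q n \<subseteq> carrier (unit_quotient R F)"
    unfolding singer_complement_eq unit_quotient_def carrier_FactGroup by (rule image_mono[OF Y(1)])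
  moreover have "comm_group (unit_quotient R F)" "finite (carrier (unit_quotient R F))"
    using U.comm_group_quotient[OF subgroup_N] fin
    by (simp_all add: unit_quotient_def carrier_FactGroup)
  ultimately show ?thesis unfolding difference_set_def by blast
qed

lemma cyclic_group_unit_quotient: "cyclic_group (unit_quotient R F)"
proof -
  interpret U: comm_group U by (rule comm_group_mult_of)
  obtain a where a: "a \<in> carrier U" "carrier U = {a [^] i | i::nat. i \<in> UNIV}"
    using finite_field_mult_group_has_gen[OF fin] by blast
  \<comment> \<open>The generator is supplied with natural exponents, whereas cyclicity is phrased
    with integer ones.\<close>
  have "carrier U = range (\<lambda>i::int. a [^]\<^bsub>U\<^esub> i)"
  proof
    show "carrier U \<subseteq> range (\<lambda>i::int. a [^]\<^bsub>U\<^esub> i)"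
    proof
      fix x assume "x \<in> carrier U"
      then obtain i :: nat where "x = a [^]\<^bsub>U\<^esub> i" using a by (auto simp: nat_pow_mult_of)
      then have "x = a [^]\<^bsub>U\<^esub> int i" by (simp add: int_pow_int)
      then show "x \<in> range (\<lambda>i::int. a [^]\<^bsub>U\<^esub> i)" by blast
    qed
  qed (use U.int_pow_closed[OF a(1)] in blast)
  then have "cyclic_group U" using U.cyclic_group a(1) by blast
  moreover have "(\<lambda>x. N #>\<^bsub>U\<^esub> x) \<in> epi U (U Mod N)"
    using normal.r_coset_hom_Mod[OF U.subgroup_imp_normal[OF subgroup_N]]
    by (simp add: epi_def carrier_FactGroup)
  ultimately show ?thesis
    unfolding unit_quotient_def
    using U.cyclic_group_epimorphic_image U.comm_group_quotient[OF subgroup_N] comm_group_def by blast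
qed

lemma order_unit_quotient: "order (unit_quotient R F) * (q - 1) = q ^ n - 1"
proof -
  interpret U: comm_group U by (rule comm_group_mult_of)
  show ?thesis
    using U.lagrange[OF subgroup_N] card_N order_U
    by (simp add: unit_quotient_def order_def FactGroup_def)
qed

section \<open>Trace-one sets in quadratic extensions\<close>

text \<open>Multiplication by \<open>h\<close> in \<open>F\<close> turns trace one into trace
  \<open>h\<close>, which excludes \<open>h\<close> other than \<open>\<one>\<close>. For
  \<open>g\<close> outside \<open>F\<close> the \<open>q\<close> elements \<open>b\<close> of trace
  one distribute evenly over the \<open>q\<close> values of \<open>tr (g \<otimes> b)\<close>, so
  exactly one has value \<open>\<one>\<close>.\<close>

lemma is_RDS_trace_one:
  assumes n: "n = 2"
  shows "is_RDS U N {x \<in> carrier R. tr x = \<one>} (q + 1) (q - 1) q 1"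
proof -
  interpret U: comm_group U by (rule comm_group_mult_of)
  let ?E = "{x \<in> carrier R. tr x = \<one>}"
  have E: "?E \<subseteq> carrier U" by auto
  have cE: "card ?E = q" using card_tr_fiber[OF F_closed(2)] n by simp
  have "diff_count U ?E h = 0" if h: "h \<in> N - {\<one>}" for h
  proof -
    have hF: "h \<in> F" "h \<in> carrier R" "h \<noteq> \<one>" "h \<noteq> \<zero>"
      using h F_carrier by (auto simp: nonzero_elts_def)
    then have eq: "{b \<in> ?E. h \<otimes>\<^bsub>U\<^esub> b \<in> ?E} = {}" by (auto simp: tr_mult)
    show ?thesis using U.diff_count_eq_card[OF E, of h, unfolded eq] hF by simp
  qed
  moreover have "diff_count U ?E g = 1" if g: "g \<in> carrier U - N" for g
  proof -
    have g': "g \<in> carrier R" "g \<notin> F" "g \<in> carrier U" using g by (auto simp: nonzero_elts_def)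
    have "card {x \<in> carrier R. tr x \<in> {\<one>}} = q * card {x \<in> carrier R. tr x \<in> {\<one>} \<and> tr (g \<otimes> x) = \<one>}"
      by (rule card_tr_pair_fiber[OF g'(1,2) F_closed(2)])
    then have "card {x \<in> carrier R. tr x = \<one> \<and> tr (g \<otimes> x) = \<one>} = 1"
      using cE q_gt_1 by simp
    moreover have eq: "{b \<in> ?E. g \<otimes>\<^bsub>U\<^esub> b \<in> ?E} = {x \<in> carrier R. tr x = \<one> \<and> tr (g \<otimes> x) = \<one>}"
      using g' by auto
    ultimately show ?thesis using U.diff_count_eq_card[OF E g'(3), unfolded eq] by simp
  qed
  moreover have "order U = (q + 1) * (q - 1)"
    using order_U n by (simp add: power2_eq_square algebra_simps diff_mult_distrib2)
  ultimately show ?thesis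
    unfolding is_RDS_def
    using comm_group_mult_of fin subgroup_N E card_N cE by auto
qed

lemma ex_nonzero_tr_zero:
  assumes "n \<ge> 2"
  obtains t where "t \<in> carrier U" "tr t = \<zero>"
proof -
  have "q ^ (n - 1) \<ge> q ^ 1" using assms q_gt_1 by (intro power_increasing) auto
  then have "card {x \<in> carrier R. tr x = \<zero>} > card {\<zero>}"
    using card_tr_fiber[OF F_closed(1)] q_gt_1 by simp
  then have "\<not> {x \<in> carrier R. tr x = \<zero>} \<subseteq> {\<zero>}"
    using card_mono[of "{\<zero>}"] by (metis finite.emptyI finite.insertI not_le)
  then show ?thesis using that by auto
qed

text \<open>If \<open>x = t \<otimes> f\<close> with \<open>f\<close> in \<open>F\<close>, then
  \<open>tr x = f \<otimes> tr t\<close> is zero, not one. Dividing by \<open>t\<close> thus moves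
  the coset that is missed onto \<open>N\<close> itself.\<close>

lemma shifted_trace_one_disjoint:
  assumes t: "t \<in> carrier U" "tr t = \<zero>"
  shows "(inv\<^bsub>U\<^esub> t <#\<^bsub>U\<^esub> {x \<in> carrier R. tr x = \<one>}) \<inter> N = {}"
proof (rule ccontr)
  interpret U: comm_group U by (rule comm_group_mult_of)
  assume "\<not> ?thesis"
  then obtain x where x: "x \<in> carrier R" "tr x = \<one>" "inv\<^bsub>U\<^esub> t \<otimes>\<^bsub>U\<^esub> x \<in> N"
    by (auto simp: l_coset_def)
  let ?f = "inv\<^bsub>U\<^esub> t \<otimes>\<^bsub>U\<^esub> x"
  have xU: "x \<in> carrier U" using x by auto
  have "t \<otimes>\<^bsub>U\<^esub> ?f = x"
    using t(1) xU by (metis U.m_assoc U.r_inv U.l_one U.inv_closed)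
  moreover have "?f \<in> F" using x by (simp add: nonzero_elts_def)
  ultimately have "tr x = ?f \<otimes> tr t"
    using tr_mult[of ?f t] t(1) F_carrier[of ?f] by (simp add: m_comm)
  then show False using x t F_carrier \<open>?f \<in> F\<close> by simp
qed

lemma simplicial_RDS_shifted_trace_one:
  assumes n: "n = 2" and t: "t \<in> carrier U" "tr t = \<zero>"
  shows "simplicial_RDS U N (inv\<^bsub>U\<^esub> t <#\<^bsub>U\<^esub> {x \<in> carrier R. tr x = \<one>}) (q + 1) (q - 1) q 1"
proof -
  interpret U: comm_group U by (rule comm_group_mult_of)
  show ?thesis
    by (intro U.simplicial_RDS_of_is_RDS U.is_RDS_l_coset is_RDS_trace_one
        shifted_trace_one_disjoint n t U.inv_closed)
qed

lemma classical_RDS_eq: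
  assumes "n = 2"
  shows "classical_RDS R q = {x \<in> carrier R. tr x = \<one>}"
proof -
  have "tr x = x \<oplus> x [^] q" if "x \<in> carrier R" for x
    using that assms
    by (simp add: field_trace_def numeral_2_eq_2 finsum_lessThan_Suc[OF abelian_monoid_axioms] a_comm)
  then show ?thesis
    \<comment> \<open>The classical set excludes zero explicitly; the trace-one set does so because
      zero has trace zero.\<close>
    unfolding classical_RDS_def using tr_zero by (auto simp del: tr_zero)
qed

end

section \<open>The tower of fields\<close>

text \<open>Powers agree by definition, but a finite sum refers to the carrier of its ring, hence
  the induction on the number of terms.\<close>

lemma field_trace_subring:
  assumes M: "subring M R" and R: "ring R" and x: "x \<in> M"
  shows "field_trace (R\<lparr>carrier := M\<rparr>) Q n x = field_trace R Q n x"
proof -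
  interpret R: ring R by fact
  interpret S: ring "R\<lparr>carrier := M\<rparr>" by (rule R.subring_is_ring[OF M])
  have pow: "x [^]\<^bsub>R\<lparr>carrier := M\<rparr>\<^esub> (k::nat) = x [^]\<^bsub>R\<^esub> k" for k
    by (simp add: nat_pow_def)
  have closed: "x [^]\<^bsub>R\<^esub> (k::nat) \<in> M" for k
    using S.nat_pow_closed[of x k] x by (simp add: pow)
  have Mc: "M \<subseteq> carrier R" by (rule subringE(1)[OF M])
  show ?thesis
    unfolding field_trace_def
  proof (induction n)
    case (Suc n)
    then show ?case
      using closed Mc
      by (subst (1 2) finsum_lessThan_Suc) (auto simp: pow intro: S.abelian_monoid_axioms R.abelian_monoid_axioms)
  qed simp
qed

locale finite_field_tower = finite_field_ext R F q "2 * J" + M: finite_field_ext R M "q ^ J" 2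
  for R (structure) and F M q J +
  assumes J: "J \<ge> 2"
begin

abbreviation "S \<equiv> R\<lparr>carrier := M\<rparr>"
abbreviation "G \<equiv> unit_quotient R F"
abbreviation "p \<equiv> (\<lambda>x. N #>\<^bsub>U\<^esub> x)"
abbreviation "H \<equiv> p ` M.N"

text \<open>Elements of \<open>F\<close> are fixed by the power \<open>q ^ J\<close>, and
  \<open>M\<close> is the full set of its fixed points.\<close>

lemma F_sub_M: "F \<subseteq> M"
proof
  fix x assume x: "x \<in> F"
  then show "x \<in> M"
    using F_pow[OF x, of J] F_carrier[OF x] M.card_F
    by (subst mem_subfield_iff_pow_card[OF fin M.subF]) auto
qed

lemma S_ext: "finite_field_ext S F q J"
proof -
  interpret S: field S by (rule subfield_iff(2)[OF M.subF])
  have "subfield F S"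
    by (rule S.subfield_iff(1)) (use subfield_iff(2)[OF subF] F_sub_M in auto)
  then show ?thesis
    using S.field_axioms M.finF card_F M.card_F q
    by (simp add: finite_field_ext_def finite_field_ext_axioms_def)
qed

text \<open>The inner trace is \<open>x \<oplus> x [^] (q ^ J)\<close>. Its powers by
  \<open>q ^ j\<close> for \<open>j < J\<close> contribute the exponents \<open>q ^ j\<close> and
  \<open>q ^ (J + j)\<close>, which together are those of the full trace.\<close>

lemma tr_tower:
  assumes x: "x \<in> carrier R"
  shows "tr x = field_trace S q J (M.tr x)"
proof -
  have Mtr: "M.tr x = x \<oplus> x [^] (q ^ J)"
    using x by (simp add: field_trace_def numeral_2_eq_2 finsum_lessThan_Suc[OF abelian_monoid_axioms] a_comm)
  have "field_trace S q J (M.tr x) = (\<Oplus>j\<in>{..<J}. (x \<oplus> x [^] (q ^ J)) [^] (q ^ j))"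
    using field_trace_subring[OF subfieldE(1)[OF M.subF] ring_axioms M.tr_in_F[OF x], of q J]
    by (simp add: Mtr) (simp add: field_trace_def)
  also have "\<dots> = (\<Oplus>j\<in>{..<J}. x [^] (q ^ j) \<oplus> x [^] (q ^ (J + j)))"
    using x by (intro finsum_cong') (auto simp: frob_add nat_pow_pow power_add)
  also have "\<dots> = (\<Oplus>j\<in>{..<J}. x [^] (q ^ j)) \<oplus> (\<Oplus>j\<in>{..<J}. x [^] (q ^ (J + j)))"
    using x by (intro finsum_addf) auto
  also have "(\<Oplus>j\<in>{..<J}. x [^] (q ^ (J + j))) = (\<Oplus>j\<in>(+) J ` {..<J}. x [^] (q ^ j))"
    using x by (subst finsum_reindex) auto
  also have "(+) J ` {..<J} = {J..<2 * J}"
    by (simp add: lessThan_atLeast0 image_add_atLeastLessThan mult_2)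
  also have "(\<Oplus>j\<in>{..<J}. x [^] (q ^ j)) \<oplus> (\<Oplus>j\<in>{J..<2 * J}. x [^] (q ^ j)) = (\<Oplus>j\<in>{..<J} \<union> {J..<2 * J}. x [^] (q ^ j))"
    using x by (intro finsum_Un_disjoint[symmetric]) auto
  also have "{..<J} \<union> {J..<2 * J} = {..<2 * J}" by auto
  finally show ?thesis by (simp add: field_trace_def)
qed

text \<open>This is an equality and not merely an isomorphism: the cosets are the same sets whether
  formed in \<open>M\<close> or in \<open>R\<close>, so facts about \<open>S\<close> over
  \<open>F\<close> become facts about a subgroup of \<open>G\<close>.\<close>

lemma unit_quotient_S: "unit_quotient S F = G\<lparr>carrier := H\<rparr>"
proof -
  have ops: "set_mult (mult_of S) = set_mult U" "r_coset (mult_of S) = r_coset U"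
    by (simp_all add: set_mult_def r_coset_def fun_eq_iff)
  have N: "nonzero_elts S F = N" and M: "carrier (mult_of S) = M.N"
    by (simp_all add: nonzero_elts_def)
  have "rcosets\<^bsub>mult_of S\<^esub> N = H"
    unfolding RCOSETS_def ops M by (rule UNION_singleton_eq_range)
  then show ?thesis
    by (simp add: unit_quotient_def FactGroup_def ops N)
qed

lemma carrier_unit_quotient_S: "carrier (unit_quotient S F) = H"
  by (simp add: unit_quotient_S)

lemma singer_complement_S:
  "singer_complement S F q J = p ` {z \<in> M. field_trace S q J z \<noteq> \<zero>}"
proof -
  have "r_coset (mult_of S) = r_coset U" "nonzero_elts S F = N" "carrier S = M" "\<zero>\<^bsub>S\<^esub> = \<zero>"
    by (simp_all add: r_coset_def nonzero_elts_def fun_eq_iff)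
  with finite_field_ext.singer_complement_eq[OF S_ext] show ?thesis by (simp only:)
qed

lemma N_sub: "N \<subseteq> M.N"
  using F_sub_M by (auto simp: nonzero_elts_def)

section \<open>Factorization of the shifted Singer complement\<close>

theorem composite_singer_complement:
  obtains c A where "c \<in> carrier G"
    "card (c <#\<^bsub>G\<^esub> singer_complement R F q (2 * J)) = q ^ (2 * J - 1)"
    "composite_with G H (c <#\<^bsub>G\<^esub> singer_complement R F q (2 * J)) A (singer_complement S F q J)"
    "simplicial_RDS G H A (q ^ J + 1) ((q ^ J - 1) div (q - 1)) (q ^ J) (q - 1)"
proof -
  interpret U: comm_group U by (rule comm_group_mult_of)
  interpret G: comm_group G
    unfolding unit_quotient_def by (rule U.comm_group_quotient[OF subgroup_N])
  have p_mult: "p (x \<otimes> y) = p x \<otimes>\<^bsub>G\<^esub> p y" if "x \<in> carrier U" "y \<in> carrier U" for x y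
    using U.r_coset_mult[OF subgroup_N that] by (simp add: unit_quotient_def)
  have p_closed: "p x \<in> carrier G" if "x \<in> carrier U" for x
    using U.r_coset_in_quotient[OF subgroup_N that] by (simp add: unit_quotient_def)
  \<comment> \<open>The single element \<open>t\<close> serves twice: its inverse shifts the
    trace-one set of \<open>R\<close> over \<open>M\<close>, and the coset of that inverse shifts
    the Singer complement.\<close>
  obtain t where t: "t \<in> carrier U" "M.tr t = \<zero>" using M.ex_nonzero_tr_zero by auto
  let ?E = "{x \<in> carrier R. M.tr x = \<one>}"
  let ?E' = "inv\<^bsub>U\<^esub> t <#\<^bsub>U\<^esub> ?E"
  let ?c = "p (inv\<^bsub>U\<^esub> t)"
  let ?X = "singer_complement R F q (2 * J)"
  let ?D = "?c <#\<^bsub>G\<^esub> ?X"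
  let ?B = "singer_complement S F q J"
  let ?A = "p ` ?E'"
  have it: "inv\<^bsub>U\<^esub> t \<in> carrier U" using t by (intro U.inv_closed)
  have c: "?c \<in> carrier G" by (rule p_closed[OF it])
  have X: "difference_set G ?X" by (rule difference_set_singer_complement)
  have Xc: "?X \<subseteq> carrier G" using X by (simp add: difference_set_def)
  have cardX: "card ?D = q ^ (2 * J - 1)"
    using G.card_l_coset[OF c Xc] card_singer_complement by simp
  have E'_RDS: "simplicial_RDS U M.N ?E' (q ^ J + 1) (q ^ J - 1) (q ^ J) 1"
    by (rule M.simplicial_RDS_shifted_trace_one[OF refl t])
  have E'c: "?E' \<subseteq> carrier U" using E'_RDS by (simp add: simplicial_RDS_def is_RDS_def)
  have "is_RDS G H ?A (q ^ J + 1) ((q ^ J - 1) div (q - 1)) (q ^ J) (q - 1)"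
  proof -
    have "is_RDS U M.N ?E' (q ^ J + 1) (q ^ J - 1) (q ^ J) 1"
      using E'_RDS unfolding simplicial_RDS_def by (rule conjunct1)
    from U.is_RDS_quotient[OF subgroup_N this N_sub] show ?thesis
      unfolding unit_quotient_def card_N mult_1_right .
  qed
  \<comment> \<open>A coset of \<open>N\<close> that meets the unit group of \<open>M\<close> lies
    inside it, so disjointness in \<open>U\<close> descends to \<open>G\<close>.\<close>
  moreover have "?A \<inter> H = {}"
  proof (rule ccontr)
    assume "?A \<inter> H \<noteq> {}"
    then obtain a m where am: "a \<in> ?E'" "m \<in> M.N" "p a = p m" by blast
    then have "\<exists>f\<in>N. a = f \<otimes>\<^bsub>U\<^esub> m"
      using U.r_coset_eq_iff[OF subgroup_N, of a m] E'c subgroup.mem_carrier[OF M.subgroup_N am(2)] by blast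
    then have "a \<in> M.N" using am N_sub subgroup.m_closed[OF M.subgroup_N] by blast
    then show False using am(1) M.shifted_trace_one_disjoint[OF t] by blast
  qed
  ultimately have A: "simplicial_RDS G H ?A (q ^ J + 1) ((q ^ J - 1) div (q - 1)) (q ^ J) (q - 1)"
    by (rule G.simplicial_RDS_of_is_RDS)
  have B: "difference_set (G\<lparr>carrier := H\<rparr>) ?B"
    using finite_field_ext.difference_set_singer_complement[OF S_ext] by (simp add: unit_quotient_S)
  have cardB: "card ?B = q ^ (J - 1)"
    by (rule finite_field_ext.card_singer_complement[OF S_ext])
  \<comment> \<open>With \<open>M.tr x = \<one>\<close> and \<open>z\<close> in \<open>M\<close> one
    has \<open>M.tr (x \<otimes> z) = z\<close>, and by transitivity the full trace of
    \<open>x \<otimes> z\<close> is the nonzero trace of \<open>z\<close>.\<close>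
  have AB: "a \<otimes>\<^bsub>G\<^esub> b \<in> ?D" if a: "a \<in> ?A" and b: "b \<in> ?B" for a b
  proof -
    obtain x where x: "x \<in> carrier R" "M.tr x = \<one>" "a = p (inv\<^bsub>U\<^esub> t \<otimes> x)"
      using a by (auto simp: l_coset_def)
    obtain z where z: "z \<in> M" "field_trace S q J z \<noteq> \<zero>" "b = p z"
      using b by (auto simp: singer_complement_S)
    have zR: "z \<in> carrier R" using z M.F_carrier by simp
    have "z \<noteq> \<zero>"
      using z finite_field_ext.tr_zero[OF S_ext] by auto
    then have xz: "x \<in> carrier U" "z \<in> carrier U" "x \<otimes> z \<in> carrier U"
      using x zR by (auto simp: integral_iff)
    have "M.tr (x \<otimes> z) = z"
      using M.tr_mult[OF z(1) x(1)] x zR by (simp add: m_comm)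
    then have "tr (x \<otimes> z) \<noteq> \<zero>" using tr_tower[of "x \<otimes> z"] z x zR by simp
    then have "p (x \<otimes> z) \<in> ?X" using x zR by (auto simp: singer_complement_eq)
    moreover have "a \<otimes>\<^bsub>G\<^esub> b = ?c \<otimes>\<^bsub>G\<^esub> p (x \<otimes> z)"
      using x(3) z(3) xz it p_closed by (simp only: p_mult G.m_assoc)
    ultimately show ?thesis by (auto simp: l_coset_def)
  qed
  have D: "difference_set G ?D" by (rule G.difference_set_l_coset[OF X c])
  have cardDAB: "card ?D = q ^ J * card ?B"
    using cardX cardB J by (simp add: power_add[symmetric] mult_2)
  have "?D \<noteq> {}" using cardX q_gt_1 by auto
  \<comment> \<open>With \<open>o\<close> the order and \<open>d\<close> the size,
    \<open>o * (Q - 1) = d * Q - 1\<close> yields \<open>o - 1 = (o - d) * Q\<close>. The radicand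
    is therefore \<open>d * Q\<close>, the square of \<open>Q ^ J\<close>.\<close>
  moreover have "S_param G ?D = real (q ^ J)"
  proof -
    let ?o = "real (order G)" and ?d = "real q ^ (2 * J - 1)" and ?Q = "real q"
    have Q: "?Q > 1" using q_gt_1 by simp
    have dQ: "?d * ?Q = ?Q ^ (2 * J)"
      using J power_Suc2[of ?Q "2 * J - 1"] by simp
    have "real (order G * (q - 1)) = real (q ^ (2 * J) - 1)"
      by (rule arg_cong[OF order_unit_quotient])
    then have o: "?o * (?Q - 1) = ?d * ?Q - 1"
      using q_gt_1 dQ by (simp add: of_nat_diff)
    have d1: "?d > 1" using J Q by (intro one_less_power) auto
    have od: "(?o - ?d) * (?Q - 1) = ?d - 1" using o by (simp add: algebra_simps)
    \<comment> \<open>Positivity of \<open>o - d\<close> permits its cancellation from the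
      fraction.\<close>
    then have pos: "?o - ?d > 0" using d1 Q by (metis diff_gt_0_iff_gt zero_less_mult_pos2)
    have "(?o - 1) * (?Q - 1) = (?d - 1) * ?Q"
      using o by (simp add: algebra_simps)
    also have "\<dots> = (?o - ?d) * ?Q * (?Q - 1)"
      unfolding od[symmetric] by (simp only: mult_ac)
    finally have "?o - 1 = (?o - ?d) * ?Q" using Q by simp
    then have "?d * (?o - 1) / (?o - ?d) = ?d * ?Q" using pos by simp
    also have "\<dots> = (?Q ^ J)\<^sup>2" using dQ by (simp add: power_mult mult.commute[of 2])
    finally show ?thesis unfolding S_param_def cardX by simp
  qed
  ultimately have "composite_with G H ?D ?A ?B"
    by (intro G.composite_with_of_simplicial[OF A B D _ AB cardDAB])
  then show ?thesis using that c cardX A by blast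
qed

end

theorem theorem4p5:
  fixes Q :: nat
    and K :: "('a, 'x) ring_scheme"
    and L :: "('b, 'y) ring_scheme"
  assumes "primepow Q"
  shows
    "(\<forall>F. finite_field_of_order K (Q ^ 2) \<and> finite_subfield_of_order F K Q \<longrightarrow>
        (\<exists>c \<in> carrier (Multiplicative_Group.mult_of K).
           simplicial_RDS (Multiplicative_Group.mult_of K) (nonzero_elts K F)
             (c <#\<^bsub>Multiplicative_Group.mult_of K\<^esub> classical_RDS K Q) (Q + 1) (Q - 1) Q 1))
   \<and>
     (\<forall>J \<ge> 2. \<forall>F M.
        finite_field_of_order L (Q ^ (2 * J)) \<and>
        finite_subfield_of_order F L Q \<and> finite_subfield_of_order M L (Q ^ J) \<longrightarrow>
        (let G = unit_quotient L F;
             H = carrier (unit_quotient (L\<lparr>carrier := M\<rparr>) F);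
             n = (Q ^ J - 1) div (Q - 1)
         in cyclic_group G \<and> order G = (Q ^ (2 * J) - 1) div (Q - 1) \<and>
            subgroup H G \<and> card H = n \<and>
            (\<exists>c \<in> carrier G.
               let D = c <#\<^bsub>G\<^esub> singer_complement L F Q (2 * J)
               in card D = Q ^ (2 * J - 1) \<and> composite_difference_set G D \<and>
                  (\<exists>A B. composite_with G H D A B \<and>
                     simplicial_RDS G H A (Q ^ J + 1) n (Q ^ J) (Q - 1) \<and>
                     B = singer_complement (L\<lparr>carrier := M\<rparr>) F Q J))))"
proof (intro conjI allI impI)
  fix F assume A: "finite_field_of_order K (Q ^ 2) \<and> finite_subfield_of_order F K Q"
  then interpret finite_field_ext K F Q 2
    using assms by (auto simp: finite_field_ext_def finite_field_ext_axioms_def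
        finite_field_of_order_def finite_subfield_of_order_def)
  obtain t where t: "t \<in> carrier U" "tr t = \<zero>\<^bsub>K\<^esub>" using ex_nonzero_tr_zero by auto
  show "\<exists>c \<in> carrier (Multiplicative_Group.mult_of K).
           simplicial_RDS (Multiplicative_Group.mult_of K) (nonzero_elts K F)
             (c <#\<^bsub>Multiplicative_Group.mult_of K\<^esub> classical_RDS K Q) (Q + 1) (Q - 1) Q 1"
    using simplicial_RDS_shifted_trace_one[OF refl t] group.inv_closed[OF field_mult_group t(1)]
    unfolding classical_RDS_eq[OF refl] by blast
next
  fix J F M assume J: "2 \<le> J"
    and A: "finite_field_of_order L (Q ^ (2 * J)) \<and>
      finite_subfield_of_order F L Q \<and> finite_subfield_of_order M L (Q ^ J)"
  \<comment> \<open>The upper step of the tower has base field of order \<open>Q ^ J\<close>, which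
    must itself be a prime power.\<close>
  have "primepow (Q ^ J)" using assms J by (subst primepow_power_iff_nat) (auto simp: primepow_gt_0_nat)
  then interpret finite_field_tower L F M Q J
    using assms A J by (auto simp: finite_field_tower_def finite_field_tower_axioms_def
        finite_field_ext_def finite_field_ext_axioms_def
        finite_field_of_order_def finite_subfield_of_order_def power_mult[symmetric] mult.commute)
  \<comment> \<open>Here \<open>B\<close> is the first factor, called \<open>A\<close> in the goal;
    the second factor is the Singer complement of the smaller field.\<close>
  obtain c B where c: "c \<in> carrier G"
    "card (c <#\<^bsub>G\<^esub> singer_complement L F Q (2 * J)) = Q ^ (2 * J - 1)"
    "composite_with G H (c <#\<^bsub>G\<^esub> singer_complement L F Q (2 * J)) B (singer_complement S F Q J)"
    "simplicial_RDS G H B (Q ^ J + 1) ((Q ^ J - 1) div (Q - 1)) (Q ^ J) (Q - 1)"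
    using composite_singer_complement .
  have o: "order G = (Q ^ (2 * J) - 1) div (Q - 1)"
    using order_unit_quotient q_gt_1 by (metis div_mult_self_is_m zero_less_diff)
  have "subgroup H G" "card H = (Q ^ J - 1) div (Q - 1)"
    using c(4) by (auto simp: simplicial_RDS_def is_RDS_def)
  then show "let G = unit_quotient L F;
             H = carrier (unit_quotient (L\<lparr>carrier := M\<rparr>) F);
             n = (Q ^ J - 1) div (Q - 1)
         in cyclic_group G \<and> order G = (Q ^ (2 * J) - 1) div (Q - 1) \<and>
            subgroup H G \<and> card H = n \<and>
            (\<exists>c \<in> carrier G.
               let D = c <#\<^bsub>G\<^esub> singer_complement L F Q (2 * J)
               in card D = Q ^ (2 * J - 1) \<and> composite_difference_set G D \<and>
                  (\<exists>A B. composite_with G H D A B \<and>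
                     simplicial_RDS G H A (Q ^ J + 1) n (Q ^ J) (Q - 1) \<and>
                     B = singer_complement (L\<lparr>carrier := M\<rparr>) F Q J))"
    unfolding Let_def carrier_unit_quotient_S
    using c o cyclic_group_unit_quotient composite_difference_set_def by blast
qed

end
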